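(* Let $k$ be a positive integer and let $G$ be a $3(k-1)$-edge-connected graph. (a) If $\sum_{v\in V(G)}[d_G(v)]_k\ge k-1$, then $G$ can be edge-decomposed into $k$ factors $G_1,\ldots, G_k$ such that for every vertex $v$ and every $i$ with $1\le i\le k$, $d_{G_i}(v)\ge \lfloor d_G(v)/k\rfloor$. (b) If $\sum_{v\in V(G)}[k-d_G(v)]_k\ge k-1$, then $G$ can be edge-decomposed into $k$ factors $G_1,\ldots, G_k$ such that for every vertex $v$ and every $i$ with $1\le i\le k$, $d_{G_i}(v)\le \lceil d_G(v)/k\rceil$.
   Context: Graphs may have loops and multiple edges; $d_G(v)$ is the degree of $v$ in $G$ (a loop counts twice). For an integer $x$, $[x]_k$ is the unique integer in $\{0,\ldots,k-1\}$ congruent to $x$ modulo $k$. A factor of $G$ is a spanning subgraph of $G$; $G$ is edge-decomposed into factors $G_1,\ldots,G_k$ if their edge sets partition $E(G)$. For a vertex set $A$, $d_G(A)$ is the number of edges of $G$ with exactly one end in $A$; $G$ is $\lambda$-edge-connected if $d_G(A)\ge\lambda$ for every nonempty proper subset $A$ of $V(G)$. *)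

theory Defs
  imports Complex_Main "HOL-Library.Uprod" "HOL-Library.Disjoint_Sets"
begin

text \<open>Undirected graphs with loops and multiple edges: edges are objects of their own, and
  each one is mapped to its unordered pair of ends. A loop at \<open>v\<close> has ends \<open>Upair v v\<close>.\<close>

record ('v, 'e) multigraph =
  verts :: "'v set"
  edges :: "'e set"
  ends :: "'e \<Rightarrow> 'v uprod"

definition finite_multigraph :: "('v, 'e) multigraph \<Rightarrow> bool" where
  "finite_multigraph G \<longleftrightarrow>
     finite (verts G) \<and> finite (edges G) \<and> (\<forall>e\<in>edges G. set_uprod (ends G e) \<subseteq> verts G)"

text \<open>The second summand makes every loop count twice.\<close>

definition degree :: "('v, 'e) multigraph \<Rightarrow> 'v \<Rightarrow> nat" where
  "degree G v =
     card {e \<in> edges G. v \<in> set_uprod (ends G e)} + card {e \<in> edges G. ends G e = Upair v v}"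

definition cut_size :: "('v, 'e) multigraph \<Rightarrow> 'v set \<Rightarrow> nat" where
  "cut_size G A = card {e \<in> edges G. \<exists>u w. ends G e = Upair u w \<and> u \<in> A \<and> w \<notin> A}"

definition edge_connected :: "nat \<Rightarrow> ('v, 'e) multigraph \<Rightarrow> bool" where
  "edge_connected l G \<longleftrightarrow> (\<forall>A. A \<noteq> {} \<and> A \<subset> verts G \<longrightarrow> cut_size G A \<ge> l)"

text \<open>A factor is a spanning subgraph. The incidence map is only relevant on the edges of the
  subgraph, so it is compared there only.\<close>

definition factor_of :: "('v, 'e) multigraph \<Rightarrow> ('v, 'e) multigraph \<Rightarrow> bool" where
  "factor_of H G \<longleftrightarrow>
     verts H = verts G \<and> edges H \<subseteq> edges G \<and> (\<forall>e\<in>edges H. ends H e = ends G e)"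

text \<open>Factors without edges are allowed, so the edge sets form an indexed partition whose
  members may be empty.\<close>

definition edge_decomposition ::
    "('v, 'e) multigraph \<Rightarrow> nat \<Rightarrow> (nat \<Rightarrow> ('v, 'e) multigraph) \<Rightarrow> bool" where
  "edge_decomposition G k F \<longleftrightarrow>
     (\<forall>i\<in>{1..k}. factor_of (F i) G) \<and>
     disjoint_family_on (\<lambda>i. edges (F i)) {1..k} \<and>
     (\<Union>i\<in>{1..k}. edges (F i)) = edges G"

definition residue :: "int \<Rightarrow> nat \<Rightarrow> int" where
  "residue x k = x mod int k"

end

theory Submission
  imports Defs
begin

text \<open>
  Orient every edge of \<open>G\<close> and split each vertex \<open>v\<close> into an out-copy and an in-copy. The result is
  a bipartite graph, and the edges of a bipartite graph can be coloured with \<open>k\<close> colours so that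
  the colours are used at each vertex as evenly as possible (\<open>equitable_colouring\<close>). If \<open>v\<close> has
  out-degree \<open>x\<close> and degree \<open>d\<close>, each colour class then has at least
  \<open>\<lfloor>x/k\<rfloor> + \<lfloor>(d - x)/k\<rfloor>\<close> and at most \<open>\<lceil>x/k\<rceil> + \<lceil>(d - x)/k\<rceil>\<close> edges at \<open>v\<close>. The first bound equals
  \<open>\<lfloor>d/k\<rfloor>\<close> exactly when \<open>x mod k \<le> d mod k\<close>, the second equals \<open>\<lceil>d/k\<rceil>\<close> exactly when
  \<open>(- x) mod k \<le> (- d) mod k\<close>. Hence it suffices to prescribe the out-degrees modulo \<open>k\<close> suitably. The
  out-degrees add up to the number of edges, and this is the only obstruction to prescribing
  them (\<open>modulo_orientation\<close>); the hypotheses on the sums of residues say that there is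
  enough room to choose the residues with the required total.

  The orientation theorem is that of Lovasz, Thomassen, Wu and Zhang, and the proof
  follows their induction. The target for a vertex is its out-degree minus its in-degree, modulo
  \<open>2k\<close>; the distance of an integer to the multiples of \<open>2k\<close> measures how many edges a set of
  vertices must spend to meet its target. The induction is over graphs with a root at which all
  edges are already oriented (\<open>rooted_orientable\<close>). Every proper set \<open>A\<close> of other vertices
  sends out at least \<open>2k - 2\<close> edges more than the distance of its target, while the root has at most
  that many edges. A set of at least two vertices for which equality holds is contracted, and
  afterwards its complement is contracted to a new root. Otherwise all proper sets of at least two vertices
  have two spare edges, so that small local changes threaten only single vertices. A
  vertex with target \<open>0\<close> is exempted from the condition and split off edge by edge. When no target is
  \<open>0\<close>, each vertex gains from sending an edge out or from receiving one. An edge of which both ends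
  can gain is oriented; if there is none, connectedness forces all vertices to gain in the same
  direction only. Then arcs to the root that point in this direction are deleted, and when none is
  left, new ones can be added at one vertex until it gains in the other direction as well, which
  allows an edge at it to be oriented (\<open>step_pad\<close>).

  Weighted simple graphs replace multigraphs in the induction: a multiplicity function is easy
  to change and to contract, and an orientation is a function counting the arcs in each
  direction, which is transferred to actual edges only at the end (\<open>realise_arc_counts\<close>).
\<close>

section \<open>Edge colourings of bipartite graphs that are balanced at every vertex\<close>

text \<open>The involutions encode two partial matchings, a fixed point being an unmatched element. Every cycle
  in their union alternates between them and is therefore even. In the induction a matched pair
  \<open>a, b\<close> of the first matching is removed, and the partners of \<open>a\<close> and \<open>b\<close> in the second one are
  matched with each other: in a colouring of the rest these get different colours, so that \<open>a\<close>
  and \<open>b\<close> can take the colours opposite to those of their partners.\<close>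

lemma two_matchings_colouring:
  fixes E :: "'e set"
  assumes "finite E"
    and "\<And>e. e \<in> E \<Longrightarrow> \<sigma> e \<in> E \<and> \<sigma> (\<sigma> e) = e" "\<And>e. e \<in> E \<Longrightarrow> \<tau> e \<in> E \<and> \<tau> (\<tau> e) = e"
  shows "\<exists>f :: 'e \<Rightarrow> bool. \<forall>e\<in>E. (\<sigma> e \<noteq> e \<longrightarrow> f (\<sigma> e) \<noteq> f e) \<and> (\<tau> e \<noteq> e \<longrightarrow> f (\<tau> e) \<noteq> f e)"
  using assms
proof (induction "card E" arbitrary: E \<sigma> \<tau> rule: less_induct)
  case less
  have step: "\<exists>f :: 'e \<Rightarrow> bool. \<forall>e\<in>E. (\<sigma> e \<noteq> e \<longrightarrow> f (\<sigma> e) \<noteq> f e) \<and> (\<tau> e \<noteq> e \<longrightarrow> f (\<tau> e) \<noteq> f e)"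
    if s: "\<And>e. e \<in> E \<Longrightarrow> \<sigma> e \<in> E \<and> \<sigma> (\<sigma> e) = e" and t: "\<And>e. e \<in> E \<Longrightarrow> \<tau> e \<in> E \<and> \<tau> (\<tau> e) = e"
      and a: "a \<in> E" "\<sigma> a \<noteq> a" for \<sigma> \<tau> a
  proof -
    define b where "b = \<sigma> a"
    have b: "b \<in> E" "\<sigma> b = a" "b \<noteq> a" using s a by (auto simp: b_def)
    define E' where "E' = E - {a, b}"
    \<comment> \<open>The partners of \<open>a\<close> and \<open>b\<close> under \<open>\<tau>\<close> are joined; if only one of them has a partner left, it becomes a fixed point.\<close>
    define \<tau>' where "\<tau>' x = (if \<tau> x \<in> {a, b} then
      if \<tau> (\<sigma> (\<tau> x)) \<in> {a, b} then x else \<tau> (\<sigma> (\<tau> x)) else \<tau> x)" for x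
    have "card E' < card E" unfolding E'_def
      by (rule psubset_card_mono[OF less.prems(1)]) (use a in auto)
    moreover have "finite E'" using less.prems(1) by (simp add: E'_def)
    moreover have "\<sigma> e \<in> E' \<and> \<sigma> (\<sigma> e) = e" if "e \<in> E'" for e
      using that s[of e] b unfolding E'_def b_def by auto
    moreover have "\<tau>' e \<in> E' \<and> \<tau>' (\<tau>' e) = e" if "e \<in> E'" for e
      using that t[of e] t[OF a(1)] t[OF b(1)] b a unfolding E'_def \<tau>'_def b_def[symmetric]
      by (auto simp: b_def[symmetric])
    ultimately have "\<exists>f :: 'e \<Rightarrow> bool. \<forall>e\<in>E'.
        (\<sigma> e \<noteq> e \<longrightarrow> f (\<sigma> e) \<noteq> f e) \<and> (\<tau>' e \<noteq> e \<longrightarrow> f (\<tau>' e) \<noteq> f e)"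
      by (rule less.hyps)
    then obtain f :: "'e \<Rightarrow> bool" where "\<forall>e\<in>E'.
        (\<sigma> e \<noteq> e \<longrightarrow> f (\<sigma> e) \<noteq> f e) \<and> (\<tau>' e \<noteq> e \<longrightarrow> f (\<tau>' e) \<noteq> f e)" ..
    note f = bspec[OF this]
    \<comment> \<open>The value \<open>True\<close> is arbitrary: it is taken when neither \<open>a\<close> nor \<open>b\<close> has a partner under \<open>\<tau>\<close> outside the pair.\<close>
    define fa where "fa = (if \<tau> a \<notin> {a, b} then \<not> f (\<tau> a) else if \<tau> b \<notin> {a, b} then f (\<tau> b) else True)"
    define g where "g e = (if e = a then fa else if e = b then \<not> fa else f e)" for e
    have ga: "g a \<noteq> g b" using b by (simp add: g_def)
    have ab: "f (\<tau> a) \<noteq> f (\<tau> b)" if "\<tau> a \<notin> {a, b}" "\<tau> b \<notin> {a, b}"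
    proof -
      have "\<tau> a \<in> E'" "\<tau>' (\<tau> a) = \<tau> b" "\<tau> b \<noteq> \<tau> a"
        using that t[OF a(1)] t[OF b(1)] b unfolding E'_def \<tau>'_def b_def by auto
      then show ?thesis using f[of "\<tau> a"] by auto
    qed
    have ta: "g (\<tau> a) \<noteq> g a" if "\<tau> a \<noteq> a"
      using that ga b by (auto simp: g_def fa_def)
    have tb: "g (\<tau> b) \<noteq> g b" if "\<tau> b \<noteq> b"
    proof (cases "\<tau> b = a")
      case True then show ?thesis using ga by simp
    next
      case False
      then have nb: "\<tau> b \<notin> {a, b}" using that by simp
      show ?thesis
      proof (cases "\<tau> a \<in> {a, b}")
        case True then show ?thesis using nb b by (auto simp: g_def fa_def)
      next
        case False then show ?thesis using nb b ab by (auto simp: g_def fa_def)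
      qed
    qed
    have "(\<sigma> e \<noteq> e \<longrightarrow> g (\<sigma> e) \<noteq> g e) \<and> (\<tau> e \<noteq> e \<longrightarrow> g (\<tau> e) \<noteq> g e)" if e: "e \<in> E" for e
    proof -
      consider "e = a" | "e = b" | "e \<in> E'" using e by (auto simp: E'_def)
      then show ?thesis
      proof cases
        case 1 then show ?thesis using ta ga b by (simp add: b_def)
      next
        case 2 then show ?thesis using tb ga b by simp
      next
        case 3
        then have ne: "e \<noteq> a" "e \<noteq> b" by (auto simp: E'_def)
        have "\<sigma> e \<noteq> a" "\<sigma> e \<noteq> b" using s[OF e] ne b by (auto simp: b_def)
        then have 1: "\<sigma> e \<noteq> e \<longrightarrow> g (\<sigma> e) \<noteq> g e" using f[OF 3] ne by (simp add: g_def)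
        have "\<tau> e \<noteq> e \<longrightarrow> g (\<tau> e) \<noteq> g e"
        proof (cases "\<tau> e = a \<or> \<tau> e = b")
          case True
          then have "e = \<tau> a \<and> \<tau> e = a \<or> e = \<tau> b \<and> \<tau> e = b" using t[OF e] by auto
          then show ?thesis using ta tb ne by metis
        next
          case False
          then have "\<tau>' e = \<tau> e" by (simp add: \<tau>'_def)
          then show ?thesis using f[OF 3] ne False by (simp add: g_def)
        qed
        with 1 show ?thesis ..
      qed
    qed
    then show ?thesis by (intro exI[of _ g] ballI)
  qed
  show ?case
  proof (cases "\<exists>a\<in>E. \<sigma> a \<noteq> a")
    case True
    then obtain a where a: "a \<in> E" "\<sigma> a \<noteq> a" by blast
    show ?thesis by (rule step[OF less.prems(2,3) a])
  next
    case False
    show ?thesis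
    proof (cases "\<exists>a\<in>E. \<tau> a \<noteq> a")
      case True
      then obtain a where a: "a \<in> E" "\<tau> a \<noteq> a" by blast
      show ?thesis using step[OF less.prems(3,2) a] by (simp only: conj_commute)
    next
      case no: False
      then show ?thesis using False by blast
    qed
  qed
qed

text \<open>Matches elements within each fibre of \<open>t\<close> as long as two are left, so at most one remains unmatched
  per fibre.\<close>

lemma fibrewise_matching:
  assumes "finite E"
  shows "\<exists>\<sigma>. (\<forall>e\<in>E. \<sigma> e \<in> E \<and> \<sigma> (\<sigma> e) = e \<and> t (\<sigma> e) = t e) \<and>
    (\<forall>e\<in>E. \<forall>e'\<in>E. \<sigma> e = e \<longrightarrow> \<sigma> e' = e' \<longrightarrow> t e = t e' \<longrightarrow> e = e')"
  using assms
proof (induction E rule: finite_induct)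
  case empty
  show ?case by simp
next
  case (insert x E)
  then obtain \<sigma> where s: "\<And>e. e \<in> E \<Longrightarrow> \<sigma> e \<in> E \<and> \<sigma> (\<sigma> e) = e \<and> t (\<sigma> e) = t e"
    and u: "\<And>e e'. e \<in> E \<Longrightarrow> e' \<in> E \<Longrightarrow> \<sigma> e = e \<Longrightarrow> \<sigma> e' = e' \<Longrightarrow> t e = t e' \<Longrightarrow> e = e'"
    by blast
  show ?case
  proof (cases "\<exists>y\<in>E. \<sigma> y = y \<and> t y = t x")
    case True
    then obtain y where y: "y \<in> E" "\<sigma> y = y" "t y = t x" by blast
    have ne: "\<sigma> e \<noteq> y" if "e \<in> E" "e \<noteq> y" for e using s[OF that(1)] y that by metis
    have "x \<noteq> y" using insert.hyps y by auto
    let ?s = "\<sigma>(x := y, y := x)"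
    have "?s e \<in> insert x E \<and> ?s (?s e) = e \<and> t (?s e) = t e" if "e \<in> insert x E" for e
      using that y s[of e] ne[of e] \<open>x \<noteq> y\<close> insert.hyps by auto
    moreover have "e = e'" if "e \<in> insert x E" "e' \<in> insert x E" "?s e = e" "?s e' = e'" "t e = t e'" for e e'
      using that u[of e e'] \<open>x \<noteq> y\<close> by (auto split: if_splits)
    ultimately show ?thesis by (intro exI[of _ ?s]) blast
  next
    case False
    let ?s = "\<sigma>(x := x)"
    have "?s e \<in> insert x E \<and> ?s (?s e) = e \<and> t (?s e) = t e" if "e \<in> insert x E" for e
      using that s[of e] insert.hyps by auto
    moreover have "e = e'" if "e \<in> insert x E" "e' \<in> insert x E" "?s e = e" "?s e' = e'" "t e = t e'" for e e'
    proof -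
      consider "e = e'" | "e = x" "e' \<noteq> x" | "e \<noteq> x" "e' = x" | "e \<noteq> x" "e' \<noteq> x" by blast
      then show ?thesis
      proof cases
        case 2
        then have "e' \<in> E" "\<sigma> e' = e'" "t e' = t x" using that by auto
        then show ?thesis using False by blast
      next
        case 3
        then have "e \<in> E" "\<sigma> e = e" "t e = t x" using that by auto
        then show ?thesis using False by blast
      next
        case 4
        then show ?thesis using that u[of e e'] by simp
      qed
    qed
    ultimately show ?thesis by (intro exI[of _ ?s]) blast
  qed
qed

lemma matching_balances:
  assumes fin: "finite E"
    and s: "\<And>e. e \<in> E \<Longrightarrow> \<sigma> e \<in> E \<and> \<sigma> (\<sigma> e) = e \<and> t (\<sigma> e) = t e"
    and u: "\<And>e e'. e \<in> E \<Longrightarrow> e' \<in> E \<Longrightarrow> \<sigma> e = e \<Longrightarrow> \<sigma> e' = e' \<Longrightarrow> t e = t e' \<Longrightarrow> e = e'"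
    and f: "\<And>e. e \<in> E \<Longrightarrow> \<sigma> e \<noteq> e \<Longrightarrow> f (\<sigma> e) \<noteq> f e"
  shows "card {e \<in> E. t e = v \<and> f e} \<le> card {e \<in> E. t e = v \<and> \<not> f e} + 1"
proof -
  define B where "B = {e \<in> E. t e = v \<and> \<not> f e}"
  define Z where "Z = {e \<in> E. t e = v \<and> \<sigma> e = e}"
  have fin': "finite B" "finite Z" using fin by (auto simp: B_def Z_def)
  have "card Z \<le> 1" using u by (auto simp: Z_def card_le_Suc0_iff_eq fin fin')
  have "e \<in> \<sigma> ` B \<union> Z" if e: "e \<in> E" "t e = v" "f e" for e
  proof (cases "\<sigma> e = e")
    case True
    then show ?thesis using e by (simp add: Z_def)
  next
    case False
    then have "\<sigma> e \<in> B" using s[OF e(1)] f[OF e(1)] e by (auto simp: B_def)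
    then show ?thesis using s[OF e(1)] by (metis UnI1 imageI)
  qed
  then have "card {e \<in> E. t e = v \<and> f e} \<le> card (\<sigma> ` B \<union> Z)"
    using fin' by (intro card_mono) auto
  also have "\<dots> \<le> card (\<sigma> ` B) + card Z" by (rule card_Un_le)
  also have "\<dots> \<le> card B + 1" using card_image_le[OF fin'(1), of \<sigma>] \<open>card Z \<le> 1\<close> by linarith
  finally show ?thesis by (simp add: B_def)
qed

text \<open>With \<open>t\<close> and \<open>h\<close> the two ends of an edge in a bipartite graph, pairing off the edges at each vertex
  gives one matching for each side of the bipartition. Colouring all pairs properly with two colours
  leaves at most one uncompensated edge per vertex.\<close>

lemma balanced_two_colouring:
  fixes E :: "'e set" and t h :: "'e \<Rightarrow> 'v"
  assumes fin: "finite E"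
  shows "\<exists>f :: 'e \<Rightarrow> bool. \<forall>s\<in>{t, h}. \<forall>v.
     card {e \<in> E. s e = v \<and> f e} \<le> card {e \<in> E. s e = v \<and> \<not> f e} + 1 \<and>
     card {e \<in> E. s e = v \<and> \<not> f e} \<le> card {e \<in> E. s e = v \<and> f e} + 1"
proof -
  obtain \<sigma> where s: "\<And>e. e \<in> E \<Longrightarrow> \<sigma> e \<in> E \<and> \<sigma> (\<sigma> e) = e \<and> t (\<sigma> e) = t e"
    and su: "\<And>e e'. e \<in> E \<Longrightarrow> e' \<in> E \<Longrightarrow> \<sigma> e = e \<Longrightarrow> \<sigma> e' = e' \<Longrightarrow> t e = t e' \<Longrightarrow> e = e'"
    using fibrewise_matching[OF fin, of t] by blast
  obtain \<tau> where t: "\<And>e. e \<in> E \<Longrightarrow> \<tau> e \<in> E \<and> \<tau> (\<tau> e) = e \<and> h (\<tau> e) = h e"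
    and tu: "\<And>e e'. e \<in> E \<Longrightarrow> e' \<in> E \<Longrightarrow> \<tau> e = e \<Longrightarrow> \<tau> e' = e' \<Longrightarrow> h e = h e' \<Longrightarrow> e = e'"
    using fibrewise_matching[OF fin, of h] by blast
  have "\<exists>f :: 'e \<Rightarrow> bool. \<forall>e\<in>E. (\<sigma> e \<noteq> e \<longrightarrow> f (\<sigma> e) \<noteq> f e) \<and> (\<tau> e \<noteq> e \<longrightarrow> f (\<tau> e) \<noteq> f e)"
    by (rule two_matchings_colouring[OF fin]) (use s t in blast)+
  then obtain f :: "'e \<Rightarrow> bool" where
    "\<forall>e\<in>E. (\<sigma> e \<noteq> e \<longrightarrow> f (\<sigma> e) \<noteq> f e) \<and> (\<tau> e \<noteq> e \<longrightarrow> f (\<tau> e) \<noteq> f e)" ..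
  note f = bspec[OF this]
  have fs: "f (\<sigma> e) \<noteq> f e" if "e \<in> E" "\<sigma> e \<noteq> e" for e using conjunct1[OF f[OF that(1)]] that(2) by (rule mp)
  have ft: "f (\<tau> e) \<noteq> f e" if "e \<in> E" "\<tau> e \<noteq> e" for e using conjunct2[OF f[OF that(1)]] that(2) by (rule mp)
  have fs': "(\<not> f (\<sigma> e)) \<noteq> (\<not> f e)" if "e \<in> E" "\<sigma> e \<noteq> e" for e using fs[OF that] by argo
  have ft': "(\<not> f (\<tau> e)) \<noteq> (\<not> f e)" if "e \<in> E" "\<tau> e \<noteq> e" for e using ft[OF that] by argo
  note bal = matching_balances[of E \<sigma> t f, OF fin s su fs]
    matching_balances[of E \<sigma> t "\<lambda>e. \<not> f e", OF fin s su fs', unfolded not_not]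
    matching_balances[of E \<tau> h f, OF fin t tu ft]
    matching_balances[of E \<tau> h "\<lambda>e. \<not> f e", OF fin t tu ft', unfolded not_not]
  show ?thesis
    by (intro exI[of _ f] ballI allI conjI; elim insertE emptyE; hypsubst; rule bal)
qed

text \<open>With the sum fixed, the sum of squares depends only on the difference, because
  \<open>2 (p\<^sup>2 + q\<^sup>2) = (p + q)\<^sup>2 + (p - q)\<^sup>2\<close>.\<close>

lemma balancing_decreases_squares:
  fixes x y x' y' :: nat
  assumes "x' + y' = x + y" "x' \<le> y' + 1" "y' \<le> x' + 1"
  shows "x'\<^sup>2 + y'\<^sup>2 \<le> x\<^sup>2 + y\<^sup>2" and "y + 2 \<le> x \<Longrightarrow> x'\<^sup>2 + y'\<^sup>2 < x\<^sup>2 + y\<^sup>2"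
proof -
  have id: "2 * (p\<^sup>2 + q\<^sup>2) = (p + q)\<^sup>2 + (p - q)\<^sup>2" for p q :: int
    by (simp add: power2_eq_square algebra_simps)
  have sum: "int x' + int y' = int x + int y" using assms(1) by linarith
  consider "int x' - int y' = 0" | "\<bar>int x' - int y'\<bar> = 1" using assms by linarith
  then have small: "(int x' - int y')\<^sup>2 \<le> (int x - int y)\<^sup>2"
  proof cases
    case 2
    have "int x - int y \<noteq> 0"
    proof
      assume "int x - int y = 0"
      then have "2 * int x' = 2 * int x + 1 \<or> 2 * int x' = 2 * int x - 1" using sum 2 by linarith
      then show False by presburger
    qed
    then have "1 \<le> \<bar>int x - int y\<bar>" by linarith
    then show ?thesis using 2 by (metis abs_le_square_iff abs_abs)
  qed simp
  then have "2 * ((int x')\<^sup>2 + (int y')\<^sup>2) \<le> 2 * ((int x)\<^sup>2 + (int y)\<^sup>2)" unfolding id sum by simp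
  then have "int (x'\<^sup>2 + y'\<^sup>2) \<le> int (x\<^sup>2 + y\<^sup>2)" by simp
  then show "x'\<^sup>2 + y'\<^sup>2 \<le> x\<^sup>2 + y\<^sup>2" by (simp only: of_nat_le_iff)
  assume "y + 2 \<le> x"
  then have "\<bar>int x' - int y'\<bar> < \<bar>int x - int y\<bar>" using assms by linarith
  then have "(int x' - int y')\<^sup>2 < (int x - int y)\<^sup>2" by (metis abs_le_square_iff not_le)
  then have "2 * ((int x')\<^sup>2 + (int y')\<^sup>2) < 2 * ((int x)\<^sup>2 + (int y)\<^sup>2)" unfolding id sum by simp
  then have "int (x'\<^sup>2 + y'\<^sup>2) < int (x\<^sup>2 + y\<^sup>2)" by simp
  then show "x'\<^sup>2 + y'\<^sup>2 < x\<^sup>2 + y\<^sup>2" by (simp only: of_nat_less_iff)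
qed

text \<open>Take a colouring that minimises the sum of the squares of all colour multiplicities at all vertices.
  If colours \<open>i\<close> and \<open>j\<close> differed by two or more at some vertex, recolouring the edges of these
  two colours evenly would not increase the sum at any vertex and would decrease it at this one.\<close>

lemma equitable_colouring:
  fixes E :: "'e set" and t h :: "'e \<Rightarrow> 'v" and k :: nat
  assumes fin: "finite E" and k: "k > 0"
  shows "\<exists>c. (\<forall>e\<in>E. c e \<in> {1..k}) \<and> (\<forall>s\<in>{t, h}. \<forall>v. \<forall>i\<in>{1..k}. \<forall>j\<in>{1..k}.
     card {e \<in> E. s e = v \<and> c e = i} \<le> card {e \<in> E. s e = v \<and> c e = j} + (1 :: nat))"
proof -
  define n where "n c s v i = card {e \<in> E. s e = v \<and> c e = i}" for c :: "'e \<Rightarrow> nat" and s :: "'e \<Rightarrow> 'v" and v and i :: nat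
  define I where "I = {t, h} \<times> (t ` E \<union> h ` E)"
  define \<Phi> where "\<Phi> c = (\<Sum>(s, v)\<in>I. \<Sum>i\<in>{1..k}. (n c s v i)\<^sup>2)" for c
  have finI: "finite I" using fin by (simp add: I_def)
  define ok where "ok c \<longleftrightarrow> (\<forall>e\<in>E. c e \<in> {1..k})" for c
  have "ok (\<lambda>e. 1)" using k by (auto simp: ok_def)
  then obtain c where c: "ok c" and least: "\<And>c'. ok c' \<Longrightarrow> \<Phi> c \<le> \<Phi> c'"
    using ex_has_least_nat[of ok _ \<Phi>] by blast
  have "n c s v i \<le> n c s v j + 1" if sv: "s \<in> {t, h}" and ij: "i \<in> {1..k}" "j \<in> {1..k}" for s v i j
  proof (rule ccontr)
    assume "\<not> ?thesis"
    then have big: "n c s v j + 2 \<le> n c s v i" by simp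
    then have "i \<noteq> j" by auto
    \<comment> \<open>Only the edges coloured \<open>i\<close> or \<open>j\<close> are recoloured.\<close>
    define D where "D = {e \<in> E. c e = i \<or> c e = j}"
    have "finite D" using fin by (simp add: D_def)
    from balanced_two_colouring[OF this, of t h] obtain f :: "'e \<Rightarrow> bool" where
      f: "\<And>s v. s \<in> {t, h} \<Longrightarrow>
       card {e \<in> D. s e = v \<and> f e} \<le> card {e \<in> D. s e = v \<and> \<not> f e} + 1 \<and>
       card {e \<in> D. s e = v \<and> \<not> f e} \<le> card {e \<in> D. s e = v \<and> f e} + 1"
      by blast
    define c' where "c' e = (if e \<in> D then if f e then i else j else c e)" for e
    have ok': "ok c'" using c ij by (auto simp: ok_def c'_def)
    have ni: "n c' s v i = card {e \<in> D. s e = v \<and> f e}" for s v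
      unfolding n_def by (rule arg_cong[of _ _ card]) (use \<open>i \<noteq> j\<close> in \<open>auto simp: c'_def D_def\<close>)
    have nj: "n c' s v j = card {e \<in> D. s e = v \<and> \<not> f e}" for s v
      unfolding n_def by (rule arg_cong[of _ _ card]) (use \<open>i \<noteq> j\<close> in \<open>auto simp: c'_def D_def\<close>)
    have nl: "n c' s v l = n c s v l" if "l \<noteq> i" "l \<noteq> j" for s v l
      unfolding n_def by (rule arg_cong[of _ _ card]) (use that in \<open>auto simp: c'_def D_def\<close>)
    have tot: "n c' s v i + n c' s v j = n c s v i + n c s v j" for s v
    proof -
      have "n c' s v i + n c' s v j = card {e \<in> D. s e = v}"
        unfolding ni nj using \<open>finite D\<close>
        by (subst card_Un_disjoint[symmetric]) (auto intro!: arg_cong[of _ _ card])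
      also have "\<dots> = n c s v i + n c s v j"
        unfolding n_def using fin \<open>i \<noteq> j\<close>
        by (subst card_Un_disjoint[symmetric]) (auto simp: D_def intro!: arg_cong[of _ _ card])
      finally show ?thesis .
    qed
    have split: "(\<Sum>l\<in>{1..k}. (n d s v l)\<^sup>2) = (n d s v i)\<^sup>2 + (n d s v j)\<^sup>2 + (\<Sum>l\<in>{1..k} - {i, j}. (n d s v l)\<^sup>2)"
      for d s v
    proof -
      have "(\<Sum>l\<in>{1..k}. (n d s v l)\<^sup>2) = (\<Sum>l\<in>{i, j}. (n d s v l)\<^sup>2) + (\<Sum>l\<in>{1..k} - {i, j}. (n d s v l)\<^sup>2)"
        using ij by (subst sum.subset_diff[of "{i, j}"]) auto
      then show ?thesis using \<open>i \<noteq> j\<close> by simp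
    qed
    have rest: "(\<Sum>l\<in>{1..k} - {i, j}. (n c' s v l)\<^sup>2) = (\<Sum>l\<in>{1..k} - {i, j}. (n c s v l)\<^sup>2)" for s v
      by (rule sum.cong) (auto simp: nl)
    have le: "(\<Sum>l\<in>{1..k}. (n c' s v l)\<^sup>2) \<le> (\<Sum>l\<in>{1..k}. (n c s v l)\<^sup>2)" if "s \<in> {t, h}" for s v
      using balancing_decreases_squares(1)[OF tot, of s v] f[OF that, of v]
      unfolding split rest ni[symmetric] nj[symmetric] by simp
    have "v \<in> s ` E"
    proof -
      have "n c s v i \<noteq> 0" using big by simp
      then have "{e \<in> E. s e = v \<and> c e = i} \<noteq> {}" unfolding n_def by (metis card.empty)
      then show ?thesis by blast
    qed
    then have inI: "(s, v) \<in> I" using sv by (auto simp: I_def)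
    have lt: "(\<Sum>l\<in>{1..k}. (n c' s v l)\<^sup>2) < (\<Sum>l\<in>{1..k}. (n c s v l)\<^sup>2)"
      using balancing_decreases_squares(2)[OF tot, of s v] f[OF sv, of v] big
      unfolding split rest ni[symmetric] nj[symmetric] by simp
    have "\<Phi> c' < \<Phi> c"
      unfolding \<Phi>_def
    proof (rule sum_strict_mono_ex1[OF finI])
      show "\<forall>x\<in>I. (case x of (s, v) \<Rightarrow> \<Sum>i\<in>{1..k}. (n c' s v i)\<^sup>2)
          \<le> (case x of (s, v) \<Rightarrow> \<Sum>i\<in>{1..k}. (n c s v i)\<^sup>2)"
        using le by (auto simp: I_def)
      show "\<exists>x\<in>I. (case x of (s, v) \<Rightarrow> \<Sum>i\<in>{1..k}. (n c' s v i)\<^sup>2)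
          < (case x of (s, v) \<Rightarrow> \<Sum>i\<in>{1..k}. (n c s v i)\<^sup>2)"
        using lt inI by (intro bexI[of _ "(s, v)"]) simp_all
    qed
    then show False using least[OF ok'] by simp
  qed
  then show ?thesis using c unfolding ok_def n_def by blast
qed

section \<open>Distance to the nearest multiple\<close>

text \<open>The distance of \<open>x\<close> to the nearest multiple of \<open>n\<close>, that is, the norm of its class on the circle
  \<open>\<int>/n\<close>. The next two lemmas characterise it as a minimum, which reduces most
  other properties to linear arithmetic.\<close>

definition circ_norm :: "int \<Rightarrow> int \<Rightarrow> int" where
  "circ_norm n x = min (x mod n) (n - x mod n)"

lemma circ_norm_le:
  assumes "n > 0"
  shows "circ_norm n x \<le> \<bar>x - n * q\<bar>"
proof -
  define d r where "d = x div n" and "r = x mod n"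
  have x: "x = n * d + r" and r: "0 \<le> r" "r < n"
    using assms by (auto simp: d_def r_def)
  show ?thesis
  proof (cases "q \<le> d")
    case True
    then have "n * q \<le> n * d" using assms by simp
    then have "r \<le> \<bar>x - n * q\<bar>" using x by linarith
    then show ?thesis by (simp add: circ_norm_def flip: r_def)
  next
    case False
    then have "n * (d + 1) \<le> n * q" using assms by (intro mult_left_mono) auto
    then show ?thesis using x r by (simp add: circ_norm_def algebra_simps flip: r_def)
  qed
qed

lemma circ_norm_attained:
  assumes "n > 0"
  obtains q where "circ_norm n x = \<bar>x - n * q\<bar>"
proof -
  define d r where "d = x div n" and "r = x mod n"
  have x: "x = n * d + r" and r: "0 \<le> r" "r < n"
    using assms by (auto simp: d_def r_def)
  show thesis
  proof (cases "r \<le> n - r")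
    case True
    then show thesis using x r that[of d] by (simp add: circ_norm_def flip: r_def)
  next
    case False
    then show thesis using x r that[of "d + 1"]
      by (simp add: circ_norm_def algebra_simps flip: r_def)
  qed
qed

lemma circ_norm_nonneg: "n > 0 \<Longrightarrow> 0 \<le> circ_norm n x"
  by (metis abs_ge_zero circ_norm_attained)

lemma circ_norm_le_half: "n > 0 \<Longrightarrow> 2 * circ_norm n x \<le> n"
  by (simp add: circ_norm_def min_def)

lemma circ_norm_le_abs: "n > 0 \<Longrightarrow> circ_norm n x \<le> \<bar>x\<bar>"
  using circ_norm_le[of n x 0] by simp

lemma circ_norm_triangle:
  assumes "n > 0"
  shows "circ_norm n (x + y) \<le> circ_norm n x + circ_norm n y"
proof -
  obtain p q where "circ_norm n x = \<bar>x - n * p\<bar>" "circ_norm n y = \<bar>y - n * q\<bar>"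
    using circ_norm_attained[OF assms] by metis
  with circ_norm_le[OF assms, of "x + y" "p + q"] show ?thesis
    by (simp add: algebra_simps)
qed

lemma circ_norm_minus:
  assumes "n > 0"
  shows "circ_norm n (- x) = circ_norm n x"
proof -
  have "circ_norm n (- y) \<le> circ_norm n y" for y
  proof -
    obtain q where "circ_norm n y = \<bar>y - n * q\<bar>"
      using circ_norm_attained[OF assms] by metis
    with circ_norm_le[OF assms, of "- y" "- q"] show ?thesis by simp
  qed
  from this[of x] this[of "- x"] show ?thesis by simp
qed

lemma circ_norm_cong:
  assumes "n dvd x - y"
  shows "circ_norm n x = circ_norm n y"
  using assms unfolding circ_norm_def by (metis mod_eq_dvd_iff)

lemma circ_norm_parity:
  assumes "n > 0" "even n"
  shows "even (circ_norm n x + x)"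
proof -
  obtain q where "circ_norm n x = \<bar>x - n * q\<bar>"
    using circ_norm_attained[OF assms(1)] by metis
  then show ?thesis using assms(2) by simp
qed

lemma circ_norm_step:
  assumes "n > 0"
  shows "circ_norm n (x + 1) \<le> circ_norm n x + 1" "circ_norm n (x - 1) \<le> circ_norm n x + 1"
    "circ_norm n x \<le> circ_norm n (x - 1) + 1"
proof -
  have 1: "circ_norm n 1 \<le> 1" using circ_norm_le_abs[OF assms, of 1] by simp
  have 2: "circ_norm n (-1) \<le> 1" using circ_norm_le_abs[OF assms, of "-1"] by simp
  show "circ_norm n (x + 1) \<le> circ_norm n x + 1" "circ_norm n (x - 1) \<le> circ_norm n x + 1"
    "circ_norm n x \<le> circ_norm n (x - 1) + 1"
    using 1 2 circ_norm_triangle[OF assms, of x 1] circ_norm_triangle[OF assms, of x "-1"]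
      circ_norm_triangle[OF assms, of "x - 1" 1] by simp_all
qed

lemma circ_norm_moves:
  assumes "n > 0" "\<not> n dvd x"
  shows "circ_norm n (x - 1) < circ_norm n x \<or> circ_norm n (x + 1) < circ_norm n x"
proof -
  obtain q where q: "circ_norm n x = \<bar>x - n * q\<bar>"
    using circ_norm_attained[OF assms(1)] by metis
  have "x \<noteq> n * q" using assms(2) by auto
  with q circ_norm_le[OF assms(1), of "x - 1" q] circ_norm_le[OF assms(1), of "x + 1" q]
  show ?thesis by linarith
qed

text \<open>If only a step down brings \<open>x\<close> closer to the multiples of \<open>2k\<close>, then \<open>x\<close> lies strictly between a
  multiple and the following antipode. At the antipode itself both steps would do.\<close>

lemma circ_norm_positive_side:
  assumes "k > 0" "circ_norm (2 * k) (x - 1) < circ_norm (2 * k) x"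
    "\<not> circ_norm (2 * k) (x + 1) < circ_norm (2 * k) x"
  shows "1 \<le> circ_norm (2 * k) x" "circ_norm (2 * k) x < k"
    "2 * k dvd x - circ_norm (2 * k) x"
proof -
  have n: "2 * k > 0" using assms(1) by simp
  obtain q where q: "circ_norm (2 * k) x = \<bar>x - 2 * k * q\<bar>"
    using circ_norm_attained[OF n] by metis
  have "x - 2 * k * q > 0"
    using assms(2,3) q circ_norm_le[OF n, of "x + 1" q] circ_norm_nonneg[OF n, of "x - 1"]
    by linarith
  with q have x: "x = 2 * k * q + circ_norm (2 * k) x" and g: "circ_norm (2 * k) x \<ge> 1" by auto
  show "1 \<le> circ_norm (2 * k) x" by fact
  show "2 * k dvd x - circ_norm (2 * k) x" using x by (metis add_diff_cancel_right' dvd_triv_left)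
  show "circ_norm (2 * k) x < k"
  proof (rule ccontr)
    assume "\<not> circ_norm (2 * k) x < k"
    with circ_norm_le_half[OF n, of x] have "circ_norm (2 * k) x = k" by simp
    with x circ_norm_le[OF n, of "x + 1" "q + 1"] assms(1,3) show False
      by (simp add: algebra_simps)
  qed
qed

section \<open>Weighted graphs with an oriented root\<close>

definition cut :: "'v set \<Rightarrow> ('v \<Rightarrow> 'v \<Rightarrow> int) \<Rightarrow> 'v set \<Rightarrow> int" where
  "cut U m A = (\<Sum>u\<in>A. \<Sum>w\<in>U - A. m u w)"

definition arc :: "'v \<Rightarrow> 'v \<Rightarrow> 'v \<Rightarrow> 'v \<Rightarrow> int" where
  "arc x y u w = (if u = x then if w = y then 1 else 0 else 0)"

text \<open>An edge as a weight function. Adding a multiple of it to a weight function changes the multiplicity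
  of that edge, and cuts respond linearly.\<close>

definition edge :: "'v \<Rightarrow> 'v \<Rightarrow> 'v \<Rightarrow> 'v \<Rightarrow> int" where
  "edge x y u w = arc x y u w + arc y x u w"

definition net :: "'v set \<Rightarrow> ('v \<Rightarrow> 'v \<Rightarrow> int) \<Rightarrow> 'v \<Rightarrow> int" where
  "net U f u = (\<Sum>w\<in>U. f u w - f w u)"

lemma edge_commute: "edge x y u w = edge x y w u"
  by (auto simp: edge_def arc_def)

lemma sum_arc_right: "finite B \<Longrightarrow> (\<Sum>w\<in>B. arc x y u w) = (if u = x \<and> y \<in> B then 1 else 0)"
  by (cases "u = x") (simp_all add: arc_def)

lemma sum_arc_left: "finite B \<Longrightarrow> (\<Sum>w\<in>B. arc x y w u) = (if u = y \<and> x \<in> B then 1 else 0)"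
  by (cases "u = y") (simp_all add: arc_def)

lemma sum_arc: "finite A \<Longrightarrow> finite B \<Longrightarrow>
    (\<Sum>u\<in>A. \<Sum>w\<in>B. arc x y u w) = (if x \<in> A \<and> y \<in> B then 1 else 0)"
  by (cases "y \<in> B") (simp_all add: sum_arc_right)

lemma cut_add_edge:
  assumes "finite U" "A \<subseteq> U" "x \<in> U" "y \<in> U"
  shows "cut U (\<lambda>u w. m u w + c * edge x y u w) A
      = cut U m A + (if (x \<in> A) \<noteq> (y \<in> A) then c else 0)"
proof -
  have f: "finite A" "finite (U - A)" using assms finite_subset by auto
  have "cut U (\<lambda>u w. m u w + c * edge x y u w) A = cut U m A
      + c * ((\<Sum>u\<in>A. \<Sum>w\<in>U-A. arc x y u w) + (\<Sum>u\<in>A. \<Sum>w\<in>U-A. arc y x u w))"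
    by (simp add: cut_def edge_def sum.distrib sum_distrib_left algebra_simps)
  then show ?thesis using f assms(3,4) by (simp add: sum_arc)
qed

lemma total_add_edge:
  assumes "finite U" "x \<in> U" "y \<in> U"
  shows "(\<Sum>u\<in>U. \<Sum>w\<in>U. m u w + c * edge x y u w) = (\<Sum>u\<in>U. \<Sum>w\<in>U. m u w) + 2 * c"
proof -
  have "(\<Sum>u\<in>U. \<Sum>w\<in>U. m u w + c * edge x y u w) = (\<Sum>u\<in>U. \<Sum>w\<in>U. m u w)
      + c * ((\<Sum>u\<in>U. \<Sum>w\<in>U. arc x y u w) + (\<Sum>u\<in>U. \<Sum>w\<in>U. arc y x u w))"
    by (simp add: edge_def sum.distrib sum_distrib_left algebra_simps)
  then show ?thesis using assms by (simp add: sum_arc)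
qed

lemma net_add_arc:
  assumes "finite U" "x \<in> U" "y \<in> U"
  shows "net U (\<lambda>u w. f u w + c * arc x y u w) u
      = net U f u + c * ((if u = x then 1 else 0) - (if u = y then 1 else 0))"
proof -
  have "net U (\<lambda>u w. f u w + c * arc x y u w) u = net U f u
      + c * ((\<Sum>w\<in>U. arc x y u w) - (\<Sum>w\<in>U. arc x y w u))"
    by (simp add: net_def sum.distrib sum_subtractf sum_distrib_left algebra_simps)
  then show ?thesis using assms by (simp add: sum_arc_right sum_arc_left)
qed

lemma sum_fun_upd_add:
  fixes h :: "'v \<Rightarrow> int"
  assumes "finite A"
  shows "sum (h(x := h x + c)) A = sum h A + (if x \<in> A then c else 0)"
proof -
  have "h(x := h x + c) = (\<lambda>u. h u + (if u = x then c else 0))" by auto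
  then show ?thesis using assms by (simp add: sum.distrib)
qed

text \<open>The number of edges leaving \<open>A\<close> in a graph with vertex set \<open>U\<close> and an additional root: \<open>a u\<close> arcs lead
  from \<open>u\<close> to the root and \<open>c u\<close> arcs from the root to \<open>u\<close>. The root is not a vertex of the type, so
  the arcs at it are recorded by these two functions.\<close>

definition bdry :: "'v set \<Rightarrow> ('v \<Rightarrow> 'v \<Rightarrow> int) \<Rightarrow> ('v \<Rightarrow> int) \<Rightarrow> ('v \<Rightarrow> int) \<Rightarrow> 'v set \<Rightarrow> int" where
  "bdry U m a c A = cut U m A + sum a A + sum c A"

text \<open>The invariant of the induction, with \<open>b u\<close> the target for out-degree minus in-degree of \<open>u\<close> modulo
  \<open>2k\<close>, arcs at the root included. The targets must add up to the net flow into the root, and every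
  boundary must have the parity of its target. The root satisfies the opposite of the boundary
  condition; this is what makes the complement of a tight set a legal root. The set \<open>X\<close> is either
  empty or the singleton of a vertex with target \<open>0\<close> from which the boundary condition is not
  required, so that this vertex can lose its edges. For \<open>A = U\<close> no condition is imposed, since its
  boundary is that of the root.\<close>

definition rooted :: "int \<Rightarrow> 'v set \<Rightarrow> ('v \<Rightarrow> 'v \<Rightarrow> int) \<Rightarrow> ('v \<Rightarrow> int) \<Rightarrow> ('v \<Rightarrow> int) \<Rightarrow>
    ('v \<Rightarrow> int) \<Rightarrow> 'v set \<Rightarrow> bool" where
  "rooted k U m a c b X \<longleftrightarrow>
     finite U \<and> (\<forall>u\<in>U. \<forall>w\<in>U. 0 \<le> m u w \<and> m u w = m w u) \<and> (\<forall>u\<in>U. 0 \<le> a u \<and> 0 \<le> c u) \<and>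
     2 * k dvd sum a U - sum c U - sum b U \<and>
     sum a U + sum c U \<le> 2 * k - 2 + circ_norm (2 * k) (sum a U - sum c U) \<and>
     (\<forall>A\<subseteq>U. even (bdry U m a c A + sum b A)) \<and>
     (\<forall>A\<subseteq>U. A \<noteq> {} \<longrightarrow> A \<noteq> U \<longrightarrow> A \<noteq> X \<longrightarrow>
        2 * k - 2 + circ_norm (2 * k) (sum b A) \<le> bdry U m a c A) \<and>
     (X = {} \<or> (\<exists>v\<in>U. X = {v} \<and> 2 * k dvd b v))"

text \<open>Here \<open>f u w\<close> is the number of edges between \<open>u\<close> and \<open>w\<close> that are oriented from \<open>u\<close> to \<open>w\<close>. The diagonal
  cancels in \<open>net\<close> and stays unconstrained.\<close>

definition orientable :: "int \<Rightarrow> 'v set \<Rightarrow> ('v \<Rightarrow> 'v \<Rightarrow> int) \<Rightarrow> ('v \<Rightarrow> int) \<Rightarrow> ('v \<Rightarrow> int) \<Rightarrow>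
    ('v \<Rightarrow> int) \<Rightarrow> bool" where
  "orientable k U m a c b \<longleftrightarrow>
     (\<exists>f. (\<forall>u\<in>U. \<forall>w\<in>U. u \<noteq> w \<longrightarrow> 0 \<le> f u w \<and> f u w + f w u = m u w) \<and>
          (\<forall>u\<in>U. 2 * k dvd net U f u + a u - c u - b u))"

lemma orientable_cong:
  assumes "orientable k U m a c b" "\<And>u. u \<in> U \<Longrightarrow> a u - c u - b u = a' u - c' u - b' u"
  shows "orientable k U m a' c' b'"
proof -
  have "net U f u + a u - c u - b u = net U f u + a' u - c' u - b' u" if "u \<in> U" for f u
    using assms(2)[OF that] by simp
  then show ?thesis using assms(1) unfolding orientable_def by metis
qed

lemma orientable_orient_edge:
  assumes "finite U" "x \<in> U" "y \<in> U" "x \<noteq> y"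
    and "orientable k U (\<lambda>u w. m u w + (-1) * edge x y u w) a c (b(x := b x + (-1), y := b y + 1))"
  shows "orientable k U m a c b"
proof -
  obtain f where f: "\<And>u w. u \<in> U \<Longrightarrow> w \<in> U \<Longrightarrow> u \<noteq> w \<Longrightarrow>
        0 \<le> f u w \<and> f u w + f w u = m u w + (-1) * edge x y u w"
    and n: "\<And>u. u \<in> U \<Longrightarrow> 2 * k dvd net U f u + a u - c u - (b(x := b x + (-1), y := b y + 1)) u"
    using assms(5) unfolding orientable_def by metis
  let ?f = "\<lambda>u w. f u w + 1 * arc x y u w"
  have "2 * k dvd net U ?f u + a u - c u - b u" if "u \<in> U" for u
  proof -
    have "net U ?f u + a u - c u - b u = net U f u + a u - c u - (b(x := b x + (-1), y := b y + 1)) u"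
      unfolding net_add_arc[OF assms(1-3)] using assms(4) by auto
    with n[OF that] show ?thesis by (simp only:)
  qed
  moreover have "0 \<le> ?f u w \<and> ?f u w + ?f w u = m u w" if "u \<in> U" "w \<in> U" "u \<noteq> w" for u w
    using f[OF that] by (auto simp: edge_def arc_def)
  ultimately show ?thesis unfolding orientable_def by (intro exI[of _ ?f]) blast
qed

text \<open>An orientation of the graph in which the path \<open>x, v, y\<close> has been replaced by an edge \<open>xy\<close> uses at
  least one arc between \<open>x\<close> and \<open>y\<close>, in some direction. Rerouting this arc through \<open>v\<close> leaves all
  net degrees unchanged.\<close>

lemma orientable_lift:
  assumes "finite U" "x \<in> U" "y \<in> U" "v \<in> U" "x \<noteq> y" "x \<noteq> v" "y \<noteq> v" "m x y \<ge> 0"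
    and "\<And>u w. u \<in> U \<Longrightarrow> w \<in> U \<Longrightarrow> m u w = m w u"
    and "orientable k U (\<lambda>u w. m u w + (-1) * edge x v u w + (-1) * edge v y u w + 1 * edge x y u w) a c b"
  shows "orientable k U m a c b"
proof -
  obtain f where f: "\<And>u w. u \<in> U \<Longrightarrow> w \<in> U \<Longrightarrow> u \<noteq> w \<Longrightarrow> 0 \<le> f u w \<and>
      f u w + f w u = m u w + (-1) * edge x v u w + (-1) * edge v y u w + 1 * edge x y u w"
    and n: "\<And>u. u \<in> U \<Longrightarrow> 2 * k dvd net U f u + a u - c u - b u"
    using assms(10) unfolding orientable_def by metis
  have main: ?thesis if pq: "p = x \<and> q = y \<or> p = y \<and> q = x" and pos: "f p q \<ge> 1" for p q
  proof -
    let ?f = "\<lambda>u w. f u w + (-1) * arc p q u w + 1 * arc p v u w + 1 * arc v q u w"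
    have U: "p \<in> U" "q \<in> U" "p \<noteq> q" "p \<noteq> v" "q \<noteq> v" using pq assms by auto
    have "net U ?f u = net U f u" if "u \<in> U" for u
      unfolding net_add_arc[OF assms(1) U(1) assms(4)] net_add_arc[OF assms(1) U(1,2)]
        net_add_arc[OF assms(1) assms(4) U(2)] using U by auto
    moreover have "0 \<le> ?f u w \<and> ?f u w + ?f w u = m u w" if "u \<in> U" "w \<in> U" "u \<noteq> w" for u w
    proof
      show "0 \<le> ?f u w" using f[OF that] pos by (auto simp: arc_def)
      show "?f u w + ?f w u = m u w" using f[OF that] pq by (auto simp: arc_def edge_def)
    qed
    ultimately show ?thesis using n unfolding orientable_def by (intro exI[of _ ?f]) auto
  qed
  have "f x y + f y x = m x y + 1"
    using f[OF assms(2,3,5)] assms(5-7) by (simp add: edge_def arc_def)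
  with assms(8) have "f x y \<ge> 1 \<or> f y x \<ge> 1" by linarith
  then show ?thesis using main by blast
qed

lemma rootedD:
  assumes "rooted k U m a c b X"
  shows "finite U" "\<And>u w. u \<in> U \<Longrightarrow> w \<in> U \<Longrightarrow> 0 \<le> m u w" "\<And>u w. u \<in> U \<Longrightarrow> w \<in> U \<Longrightarrow> m u w = m w u"
    "\<And>u. u \<in> U \<Longrightarrow> 0 \<le> a u" "\<And>u. u \<in> U \<Longrightarrow> 0 \<le> c u" "2 * k dvd sum a U - sum c U - sum b U"
    "sum a U + sum c U \<le> 2 * k - 2 + circ_norm (2 * k) (sum a U - sum c U)"
    "\<And>A. A \<subseteq> U \<Longrightarrow> even (bdry U m a c A + sum b A)"
    "\<And>A. A \<subseteq> U \<Longrightarrow> A \<noteq> {} \<Longrightarrow> A \<noteq> U \<Longrightarrow> A \<noteq> X \<Longrightarrow>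
        2 * k - 2 + circ_norm (2 * k) (sum b A) \<le> bdry U m a c A"
    "X = {} \<or> (\<exists>v\<in>U. X = {v} \<and> 2 * k dvd b v)"
  using assms unfolding rooted_def by (elim conjE; simp)+

lemma rootedI:
  assumes "finite U" "\<And>u w. u \<in> U \<Longrightarrow> w \<in> U \<Longrightarrow> 0 \<le> m u w" "\<And>u w. u \<in> U \<Longrightarrow> w \<in> U \<Longrightarrow> m u w = m w u"
    "\<And>u. u \<in> U \<Longrightarrow> 0 \<le> a u" "\<And>u. u \<in> U \<Longrightarrow> 0 \<le> c u" "2 * k dvd sum a U - sum c U - sum b U"
    "sum a U + sum c U \<le> 2 * k - 2 + circ_norm (2 * k) (sum a U - sum c U)"
    "\<And>A. A \<subseteq> U \<Longrightarrow> even (bdry U m a c A + sum b A)"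
    "\<And>A. A \<subseteq> U \<Longrightarrow> A \<noteq> {} \<Longrightarrow> A \<noteq> U \<Longrightarrow> A \<noteq> X \<Longrightarrow>
        2 * k - 2 + circ_norm (2 * k) (sum b A) \<le> bdry U m a c A"
    "X = {} \<or> (\<exists>v\<in>U. X = {v} \<and> 2 * k dvd b v)"
  shows "rooted k U m a c b X"
  unfolding rooted_def by (intro conjI ballI allI impI assms)

text \<open>By parity, a set that is not tight has two spare edges.\<close>

definition loose :: "int \<Rightarrow> 'v set \<Rightarrow> ('v \<Rightarrow> 'v \<Rightarrow> int) \<Rightarrow> ('v \<Rightarrow> int) \<Rightarrow> ('v \<Rightarrow> int) \<Rightarrow>
    ('v \<Rightarrow> int) \<Rightarrow> bool" where
  "loose k U m a c b \<longleftrightarrow> (\<forall>A\<subseteq>U. 2 \<le> card A \<longrightarrow> A \<noteq> U \<longrightarrow>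
     2 * k + circ_norm (2 * k) (sum b A) \<le> bdry U m a c A)"

definition size_order :: "((nat \<times> nat \<times> nat) \<times> (nat \<times> nat \<times> nat)) set" where
  "size_order = less_than <*lex*> less_than <*lex*> less_than"

text \<open>Contraction and deletion reduce the number of vertices. All other steps keep it; among them, those
  that may add arcs at the root remove an edge between other vertices, so the arcs at the root are
  counted last.\<close>

definition instance_size :: "'v set \<Rightarrow> ('v \<Rightarrow> 'v \<Rightarrow> int) \<Rightarrow> ('v \<Rightarrow> int) \<Rightarrow> ('v \<Rightarrow> int) \<Rightarrow>
    nat \<times> nat \<times> nat" where
  "instance_size U m a c = (card U, nat (\<Sum>u\<in>U. \<Sum>w\<in>U. m u w), nat (sum a U + sum c U))"

definition solvable_below :: "int \<Rightarrow> 'v set \<Rightarrow> ('v \<Rightarrow> 'v \<Rightarrow> int) \<Rightarrow> ('v \<Rightarrow> int) \<Rightarrow> ('v \<Rightarrow> int) \<Rightarrow> bool" where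
  "solvable_below k U m a c \<longleftrightarrow> (\<forall>(U' :: 'v set) m' a' c' b' X'.
     (instance_size U' m' a' c', instance_size U m a c) \<in> size_order \<longrightarrow> rooted k U' m' a' c' b' X' \<longrightarrow>
     orientable k U' m' a' c' b')"

lemma solvable_belowD:
  fixes U U' :: "'v set"
  assumes "solvable_below k U m a c" "rooted k U' m' a' c' b' X'"
    "(instance_size U' m' a' c', instance_size U m a c) \<in> size_order"
  shows "orientable k U' m' a' c' b'"
  using assms unfolding solvable_below_def by blast

lemma smaller_vertices:
  "card U' < card U \<Longrightarrow> (instance_size U' m' a' c', instance_size U m a c) \<in> size_order"
  by (simp add: instance_size_def size_order_def)

lemma smaller_edges:
  assumes "(\<Sum>u\<in>U. \<Sum>w\<in>U. m' u w) < (\<Sum>u\<in>U. \<Sum>w\<in>U. m u w)"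
    "\<And>u w. u \<in> U \<Longrightarrow> w \<in> U \<Longrightarrow> 0 \<le> m' u w"
  shows "(instance_size U m' a' c', instance_size U m a c) \<in> size_order"
proof -
  have "0 \<le> (\<Sum>u\<in>U. \<Sum>w\<in>U. m' u w)" using assms(2) by (intro sum_nonneg) auto
  then show ?thesis using assms(1) by (simp add: instance_size_def size_order_def)
qed

lemma smaller_root:
  assumes "sum a' U + sum c' U < sum a U + sum c U" "0 \<le> sum a' U + sum c' U"
  shows "(instance_size U m a' c', instance_size U m a c) \<in> size_order"
  using assms by (simp add: instance_size_def size_order_def)

lemma singleton_or_big:
  assumes "finite U" "A \<subseteq> U" "A \<noteq> {}"
  obtains u where "u \<in> U" "A = {u}" | "2 \<le> card A"
proof -
  have "finite A" using assms finite_subset by blast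
  then have "card A \<noteq> 0" using assms by auto
  then consider "card A = 1" | "2 \<le> card A" by linarith
  then show thesis using that assms(2) by (metis card_1_singletonE insert_subset)
qed

lemma sum_fun_upd_add2:
  fixes h :: "'v \<Rightarrow> int"
  assumes "finite A" "x \<noteq> y"
  shows "sum (h(x := h x + c, y := h y + d)) A
    = sum h A + (if x \<in> A then c else 0) + (if y \<in> A then d else 0)"
  using sum_fun_upd_add[OF assms(1), of "h(x := h x + c)" y d] sum_fun_upd_add[OF assms(1), of h x c] assms(2)
  by simp

section \<open>Orienting edges when no target vanishes\<close>

text \<open>Orienting an edge from \<open>x\<close> to \<open>y\<close> and deleting it lowers the target of \<open>x\<close> and raises that of \<open>y\<close>. Both
  ends lose an edge, but their targets come closer to the multiples of \<open>2k\<close> by the same amount; a larger set loses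
  at most one edge and its target moves away by at most one, which the spare edges cover.\<close>

lemma step_orient_edge:
  assumes k: "k > 0" and R: "rooted k U m a c b {}" and L: "loose k U m a c b"
    and IH: "solvable_below k U m a c" and xy: "x \<in> U" "y \<in> U" "x \<noteq> y" "m x y > 0"
    and dn: "circ_norm (2 * k) (b x - 1) < circ_norm (2 * k) (b x)"
    and up: "circ_norm (2 * k) (b y + 1) < circ_norm (2 * k) (b y)"
  shows "orientable k U m a c b"
proof -
  note D = rootedD[OF R]
  have n: "2 * k > 0" using k by simp
  let ?m = "\<lambda>u w. m u w + (-1) * edge x y u w"
  let ?b = "b(x := b x + (-1), y := b y + 1)"
  have bd: "bdry U ?m a c A = bdry U m a c A + (if (x \<in> A) \<noteq> (y \<in> A) then -1 else 0)"
    if "A \<subseteq> U" for A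
    unfolding bdry_def cut_add_edge[OF D(1) that xy(1,2)] by simp
  have sb: "sum ?b A = sum b A + (if x \<in> A then -1 else 0) + (if y \<in> A then 1 else 0)"
    if "A \<subseteq> U" for A
    using sum_fun_upd_add2[OF finite_subset[OF that D(1)] xy(3)] .
  have nn: "0 \<le> ?m u w" if "u \<in> U" "w \<in> U" for u w
    using D(2)[OF that] xy(3,4) D(3)[OF xy(1,2)] by (auto simp: edge_def arc_def)
  have "rooted k U ?m a c ?b {}"
  proof (rule rootedI)
    show "?m u w = ?m w u" if "u \<in> U" "w \<in> U" for u w
      using D(3)[OF that] edge_commute[of x y u w] by simp
    show "2 * k dvd sum a U - sum c U - sum ?b U"
      using D(6) xy sb[of U] by simp
    show "even (bdry U ?m a c A + sum ?b A)" if A: "A \<subseteq> U" for A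
      using D(8)[OF A] unfolding bd[OF A] sb[OF A] by auto
    show "2 * k - 2 + circ_norm (2 * k) (sum ?b A) \<le> bdry U ?m a c A"
      if A: "A \<subseteq> U" "A \<noteq> {}" "A \<noteq> U" "A \<noteq> {}" for A
    proof (rule singleton_or_big[OF D(1) A(1,2)])
      fix u assume "u \<in> U" "A = {u}"
      then show ?thesis
        using D(9)[OF A] dn up xy(3) unfolding bd[OF A(1)] sb[OF A(1)] by auto
    next
      assume "2 \<le> card A"
      then have "2 * k + circ_norm (2 * k) (sum b A) \<le> bdry U m a c A"
        using L A unfolding loose_def by blast
      then show ?thesis
        using circ_norm_step[OF n, of "sum b A"] unfolding bd[OF A(1)] sb[OF A(1)] by auto
    qed
  qed (use D nn in auto)
  moreover have "(instance_size U ?m a c, instance_size U m a c) \<in> size_order"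
    by (rule smaller_edges) (use nn total_add_edge[OF D(1) xy(1,2), of m "-1"] in auto)
  ultimately show ?thesis
    using orientable_orient_edge[OF D(1) xy(1-3)] solvable_belowD[OF IH] by blast
qed

text \<open>An arc from \<open>x\<close> to the root can be deleted together with its contribution to the target of \<open>x\<close>. The
  degree of the root falls by one, and the distance of its flow to the multiples of \<open>2k\<close> by at most one.\<close>

lemma step_absorb:
  assumes k: "k > 0" and R: "rooted k U m a c b {}" and L: "loose k U m a c b"
    and IH: "solvable_below k U m a c" and x: "x \<in> U" "a x > 0"
    and dn: "circ_norm (2 * k) (b x - 1) < circ_norm (2 * k) (b x)"
  shows "orientable k U m a c b"
proof -
  note D = rootedD[OF R]
  have n: "2 * k > 0" using k by simp
  let ?a = "a(x := a x + (-1))"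
  let ?b = "b(x := b x + (-1))"
  have sa: "sum ?a A = sum a A + (if x \<in> A then -1 else 0)" if "A \<subseteq> U" for A
    using sum_fun_upd_add[OF finite_subset[OF that D(1)]] .
  have sb: "sum ?b A = sum b A + (if x \<in> A then -1 else 0)" if "A \<subseteq> U" for A
    using sum_fun_upd_add[OF finite_subset[OF that D(1)]] .
  have bd: "bdry U m ?a c A = bdry U m a c A + (if x \<in> A then -1 else 0)"
    if "A \<subseteq> U" for A
    unfolding bdry_def sa[OF that] by simp
  have nn: "0 \<le> ?a u" if "u \<in> U" for u using D(4)[OF that] x(2) by auto
  have "rooted k U m ?a c ?b {}"
  proof (rule rootedI)
    show "2 * k dvd sum ?a U - sum c U - sum ?b U"
    proof -
      have "sum ?a U - sum c U - sum ?b U = sum a U - sum c U - sum b U"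
        using sa[of U] sb[of U] x(1) by simp
      then show ?thesis using D(6) by (simp only:)
    qed
    show "sum ?a U + sum c U \<le> 2 * k - 2 + circ_norm (2 * k) (sum ?a U - sum c U)"
    proof -
      have e: "sum ?a U - sum c U = sum a U - sum c U - 1" "sum ?a U = sum a U - 1"
        using sa[of U] x(1) by simp_all
      show ?thesis using D(7) circ_norm_step(3)[OF n, of "sum a U - sum c U"]
        unfolding e(1) unfolding e(2) by linarith
    qed
    show "even (bdry U m ?a c A + sum ?b A)" if A: "A \<subseteq> U" for A
      using D(8)[OF A] unfolding bd[OF A] sb[OF A] by auto
    show "2 * k - 2 + circ_norm (2 * k) (sum ?b A) \<le> bdry U m ?a c A"
      if A: "A \<subseteq> U" "A \<noteq> {}" "A \<noteq> U" "A \<noteq> {}" for A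
    proof (rule singleton_or_big[OF D(1) A(1,2)])
      fix u assume "u \<in> U" "A = {u}"
      then show ?thesis
        using D(9)[OF A] dn unfolding bd[OF A(1)] sb[OF A(1)] by auto
    next
      assume "2 \<le> card A"
      then have "2 * k + circ_norm (2 * k) (sum b A) \<le> bdry U m a c A"
        using L A unfolding loose_def by blast
      then show ?thesis
        using circ_norm_step[OF n, of "sum b A"] unfolding bd[OF A(1)] sb[OF A(1)] by auto
    qed
  qed (use D nn in auto)
  moreover have "(instance_size U m ?a c, instance_size U m a c) \<in> size_order"
  proof (rule smaller_root)
    show "sum ?a U + sum c U < sum a U + sum c U" using sa[of U] x(1) by simp
    show "0 \<le> sum ?a U + sum c U" using nn D(5) by (intro add_nonneg_nonneg sum_nonneg) auto
  qed
  ultimately have "orientable k U m ?a c ?b" using solvable_belowD[OF IH] by blast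
  then show ?thesis by (rule orientable_cong) auto
qed

text \<open>All arcs leave the root. If \<open>D\<close> were at least \<open>2k\<close>, the multiple \<open>2k\<close> would be at distance
  \<open>D - 2k\<close> only, too near for the bound.\<close>

lemma root_degree_bound:
  assumes k: "k > 0" and D: "D \<le> 2 * k - 2 + circ_norm (2 * k) (- D)" and "D \<ge> 0"
  shows "D \<le> 2 * k - 1"
proof -
  have "circ_norm (2 * k) (- D) \<le> \<bar>- D - 2 * k * (- 1)\<bar>" using circ_norm_le[of "2 * k" "- D" "-1"] k by simp
  then show ?thesis using D assms(3) by (cases "D \<le> 2 * k") auto
qed

text \<open>Adding \<open>j\<close> arcs into a root with \<open>D\<close> outgoing arcs preserves the degree bound: if the
  nearest multiple of \<open>2k\<close> to \<open>j - D\<close> is \<open>0\<close>, the smaller one of \<open>D\<close> and \<open>j\<close> must be at most \<open>k - 1\<close>; if it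
  is another one, \<open>D\<close> or \<open>j\<close> must be at most \<open>2k - 1\<close>, depending on the side.\<close>

lemma root_degree_after_padding:
  assumes k: "k > 0" and D: "0 \<le> D" "D \<le> 2 * k - 1" and j: "1 \<le> j" "j \<le> k - 1"
  shows "D + j \<le> 2 * k - 2 + circ_norm (2 * k) (j - D)"
proof -
  have n: "2 * k > 0" using k by simp
  obtain q where q: "circ_norm (2 * k) (j - D) = \<bar>(j - D) - 2 * k * q\<bar>"
    using circ_norm_attained[OF n] by metis
  \<comment> \<open>The nearest multiple is \<open>2kq\<close>.\<close>
  consider "q = 0" | "q \<le> -1" | "q \<ge> 1" by linarith
  then show ?thesis
  proof cases
    case 1
    then show ?thesis using q D j by simp
  next
    case 2
    then have "2 * k * q \<le> 2 * k * (-1)" using n by (intro mult_left_mono) auto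
    then show ?thesis using q D j by linarith
  next
    case 3
    then have "2 * k * 1 \<le> 2 * k * q" using n by (intro mult_left_mono) auto
    then show ?thesis using q D j by linarith
  qed
qed

text \<open>Suppose that all arcs at the root leave it. The vertex \<open>x\<close> gains by sending out the edge \<open>xy\<close>, but \<open>y\<close>
  does not gain by receiving it. Adding \<open>j = k - \<parallel>b y\<parallel>\<close> arcs from \<open>y\<close> to the root,
  where \<open>\<parallel>b y\<parallel>\<close> is the distance of \<open>b y\<close> to the multiples of \<open>2k\<close>, and raising the target of \<open>y\<close>
  accordingly does not change the problem, but it moves the target of \<open>y\<close> to the antipode \<open>k\<close>. There a
  further step up is a step towards \<open>2k\<close>, so \<open>y\<close> can now receive the edge \<open>xy\<close>.\<close>

lemma step_pad:
  assumes k: "k > 0" and R: "rooted k U m a c b {}" and L: "loose k U m a c b"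
    and IH: "solvable_below k U m a c" and xy: "x \<in> U" "y \<in> U" "x \<noteq> y" "m x y > 0"
    and a0: "sum a U = 0"
    and dn: "circ_norm (2 * k) (b x - 1) < circ_norm (2 * k) (b x)"
    and ypos: "circ_norm (2 * k) (b y - 1) < circ_norm (2 * k) (b y)"
       "\<not> circ_norm (2 * k) (b y + 1) < circ_norm (2 * k) (b y)"
  shows "orientable k U m a c b"
proof -
  note D = rootedD[OF R]
  have n: "2 * k > 0" using k by simp
  define r where "r = circ_norm (2 * k) (b y)"
  define j where "j = k - r"
  note P = circ_norm_positive_side[OF k ypos, folded r_def]
  have j: "1 \<le> j" "j \<le> k - 1" using P(1,2) by (auto simp: j_def)
  let ?m = "\<lambda>u w. m u w + (-1) * edge x y u w"
  let ?a = "a(y := a y + j)"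
  let ?b = "b(x := b x + (-1), y := b y + (j + 1))"
  have sa: "sum ?a A = sum a A + (if y \<in> A then j else 0)" if "A \<subseteq> U" for A
    using sum_fun_upd_add[OF finite_subset[OF that D(1)]] .
  have bd: "bdry U ?m ?a c A = bdry U m a c A + (if (x \<in> A) \<noteq> (y \<in> A) then -1 else 0)
      + (if y \<in> A then j else 0)" if "A \<subseteq> U" for A
    unfolding bdry_def cut_add_edge[OF D(1) that xy(1,2)] sa[OF that] by simp
  have sb: "sum ?b A = sum b A + (if x \<in> A then -1 else 0) + (if y \<in> A then j + 1 else 0)"
    if "A \<subseteq> U" for A
    using sum_fun_upd_add2[OF finite_subset[OF that D(1)] xy(3)] .
  have nn: "0 \<le> ?m u w" if "u \<in> U" "w \<in> U" for u w
    using D(2)[OF that] xy(3,4) D(3)[OF xy(1,2)] by (auto simp: edge_def arc_def)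
  have c: "0 \<le> sum c U" "sum c U \<le> 2 * k - 1"
  proof -
    show "0 \<le> sum c U" using D(5) by (intro sum_nonneg)
    then show "sum c U \<le> 2 * k - 1" using root_degree_bound[OF k] D(7) a0 by simp
  qed
  have "rooted k U ?m ?a c ?b {}"
  proof (rule rootedI)
    show "?m u w = ?m w u" if "u \<in> U" "w \<in> U" for u w
      using D(3)[OF that] edge_commute[of x y u w] by simp
    show "2 * k dvd sum ?a U - sum c U - sum ?b U"
    proof -
      have "sum ?a U - sum c U - sum ?b U = sum a U - sum c U - sum b U"
        using sa[of U] sb[of U] xy by simp
      then show ?thesis using D(6) by (simp only:)
    qed
    show "sum ?a U + sum c U \<le> 2 * k - 2 + circ_norm (2 * k) (sum ?a U - sum c U)"
      using root_degree_after_padding[OF k c j] sa[of U] a0 xy(2) by (simp add: add.commute)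
    show "even (bdry U ?m ?a c A + sum ?b A)" if A: "A \<subseteq> U" for A
      using D(8)[OF A] unfolding bd[OF A] sb[OF A] by auto
    show "2 * k - 2 + circ_norm (2 * k) (sum ?b A) \<le> bdry U ?m ?a c A"
      if A: "A \<subseteq> U" "A \<noteq> {}" "A \<noteq> U" "A \<noteq> {}" for A
    proof (rule singleton_or_big[OF D(1) A(1,2)])
      fix u assume u: "u \<in> U" "A = {u}"
      show ?thesis
      proof (cases "u = y")
        case True
        \<comment> \<open>The new target is one beyond the antipode, at distance \<open>k - 1\<close> from \<open>2k\<close>, while the boundary has grown by \<open>j - 1\<close>.\<close>
        have "2 * k dvd (b y + j + 1) - (k + 1)" using P(3) by (simp add: j_def)
        then have "circ_norm (2 * k) (b y + j + 1) = circ_norm (2 * k) (k + 1)"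
          by (rule circ_norm_cong)
        also have "\<dots> \<le> \<bar>(k + 1) - 2 * k * 1\<bar>" by (rule circ_norm_le[OF n])
        also have "\<dots> = k - 1" using j by simp
        finally have "circ_norm (2 * k) (b y + j + 1) \<le> k - 1" .
        then show ?thesis
          using D(9)[OF A] xy(3) True u unfolding bd[OF A(1)] sb[OF A(1)]
          by (simp add: j_def add.assoc flip: r_def)
      next
        case False
        then show ?thesis
          using D(9)[OF A] dn xy(3) u unfolding bd[OF A(1)] sb[OF A(1)] by auto
      qed
    next
      assume "2 \<le> card A"
      then have g: "2 * k + circ_norm (2 * k) (sum b A) \<le> bdry U m a c A"
        using L A unfolding loose_def by blast
      have "circ_norm (2 * k) (sum b A + i) \<le> circ_norm (2 * k) (sum b A) + \<bar>i\<bar>" for i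
        using circ_norm_triangle[OF n, of "sum b A" i] circ_norm_le_abs[OF n, of i] by linarith
      from this[of "-1"] this[of "j"] this[of "j + 1"] g j show ?thesis
        unfolding bd[OF A(1)] sb[OF A(1)] by (auto simp: add.assoc)
    qed
  qed (use D nn j in auto)
  moreover have "(instance_size U ?m ?a c, instance_size U m a c) \<in> size_order"
    by (rule smaller_edges) (use nn total_add_edge[OF D(1) xy(1,2), of m "-1"] in auto)
  ultimately have "orientable k U ?m ?a c ?b" using solvable_belowD[OF IH] by blast
  then have "orientable k U ?m a c (b(x := b x + (-1), y := b y + 1))"
    by (rule orientable_cong) (use xy(3) in auto)
  then show ?thesis by (rule orientable_orient_edge[OF D(1) xy(1-3)])
qed

lemma sum_split: "finite U \<Longrightarrow> A \<subseteq> U \<Longrightarrow> sum h U = sum h A + sum (h :: 'v \<Rightarrow> int) (U - A)"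
  by (metis add.commute sum.subset_diff)

text \<open>If no edge joined \<open>A\<close> to its complement, the boundaries of both would consist of arcs at the root.
  By the triangle inequality the root would then have at least \<open>2k - 2\<close> arcs too many.\<close>

lemma rooted_connected:
  assumes k: "k \<ge> 2" and R: "rooted k U m a c b X"
    and A: "A \<subseteq> U" "A \<noteq> {}" "A \<noteq> U" "A \<noteq> X" "U - A \<noteq> X"
  shows "\<exists>x\<in>A. \<exists>y\<in>U - A. m x y > 0"
proof (rule ccontr)
  note D = rootedD[OF R]
  have n: "2 * k > 0" using k by simp
  assume no: "\<not> (\<exists>x\<in>A. \<exists>y\<in>U - A. m x y > 0)"
  have z: "m x y = 0" "m y x = 0" if "x \<in> A" "y \<in> U - A" for x y
    using no that D(2)[of x y] D(3)[of x y] A(1) by force+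
  have "U - (U - A) = A" using A(1) by blast
  then have "cut U m A = 0" "cut U m (U - A) = 0" using z by (simp_all add: cut_def)
  then have "2 * k - 2 + circ_norm (2 * k) (sum b A) \<le> sum a A + sum c A"
    "2 * k - 2 + circ_norm (2 * k) (sum b (U - A)) \<le> sum a (U - A) + sum c (U - A)"
    using D(9)[of A] D(9)[of "U - A"] A by (auto simp: bdry_def)
  moreover have "circ_norm (2 * k) (sum a U - sum c U) = circ_norm (2 * k) (sum b U)"
    by (rule circ_norm_cong) (use D(6) in simp)
  moreover have "circ_norm (2 * k) (sum b U)
      \<le> circ_norm (2 * k) (sum b A) + circ_norm (2 * k) (sum b (U - A))"
    unfolding sum_split[OF D(1) A(1), of b] by (rule circ_norm_triangle[OF n])
  ultimately show False
    using D(7) k sum_split[OF D(1) A(1), of a] sum_split[OF D(1) A(1), of c] by linarith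
qed

text \<open>Reversing all arcs exchanges the two kinds of root arcs and negates the targets. This symmetry,
  which the following lemmas express for the other notions, allows only one of the two directions
  to be treated.\<close>

lemma orientable_negate:
  assumes "orientable k U m c a (\<lambda>u. - b u)"
  shows "orientable k U m a c b"
proof -
  obtain f where f: "\<And>u w. u \<in> U \<Longrightarrow> w \<in> U \<Longrightarrow> u \<noteq> w \<Longrightarrow> 0 \<le> f u w \<and> f u w + f w u = m u w"
    and n: "\<And>u. u \<in> U \<Longrightarrow> 2 * k dvd net U f u + c u - a u - (- b u)"
    using assms unfolding orientable_def by metis
  have "net U (\<lambda>u w. f w u) u + a u - c u - b u = - (net U f u + c u - a u - (- b u))" for u
    by (simp add: net_def sum_subtractf algebra_simps)
  then have "2 * k dvd net U (\<lambda>u w. f w u) u + a u - c u - b u" if "u \<in> U" for u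
    using n[OF that] by (metis dvd_minus_iff)
  moreover have "0 \<le> f w u \<and> f w u + f u w = m u w" if "u \<in> U" "w \<in> U" "u \<noteq> w" for u w
    using f[of u w] f[of w u] that by simp
  ultimately show ?thesis unfolding orientable_def by (intro exI[of _ "\<lambda>u w. f w u"]) blast
qed

lemma bdry_swap: "bdry U m c a A = bdry U m a c A"
  by (simp add: bdry_def)

lemma rooted_negate:
  assumes k: "k > 0" and R: "rooted k U m a c b X"
  shows "rooted k U m c a (\<lambda>u. - b u) X"
proof -
  note D = rootedD[OF R]
  have n: "2 * k > 0" using k by simp
  have s: "sum (\<lambda>u. - b u) A = - sum b A" for A by (rule sum_negf)
  have "sum c U - sum a U = - (sum a U - sum c U)" by simp
  then have 7: "circ_norm (2 * k) (sum c U - sum a U) = circ_norm (2 * k) (sum a U - sum c U)"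
    using circ_norm_minus[OF n] by metis
  show ?thesis
  proof (rule rootedI)
    have "sum c U - sum a U - sum (\<lambda>u. - b u) U = - (sum a U - sum c U - sum b U)" by (simp add: s)
    then show "2 * k dvd sum c U - sum a U - sum (\<lambda>u. - b u) U"
      using D(6) by (metis dvd_minus_iff)
    show "sum c U + sum a U \<le> 2 * k - 2 + circ_norm (2 * k) (sum c U - sum a U)"
      using D(7) 7 by simp
    show "even (bdry U m c a A + sum (\<lambda>u. - b u) A)" if "A \<subseteq> U" for A
      using D(8)[OF that] by (simp add: s bdry_swap)
    show "2 * k - 2 + circ_norm (2 * k) (sum (\<lambda>u. - b u) A) \<le> bdry U m c a A"
      if "A \<subseteq> U" "A \<noteq> {}" "A \<noteq> U" "A \<noteq> X" for A
      using D(9)[OF that] by (simp add: s bdry_swap circ_norm_minus[OF n])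
  qed (use D in auto)
qed

lemma loose_negate:
  assumes k: "k > 0" and "loose k U m a c b"
  shows "loose k U m c a (\<lambda>u. - b u)"
  using assms unfolding loose_def by (simp add: sum_negf bdry_swap circ_norm_minus)

lemma solvable_below_swap:
  assumes "solvable_below k U m a c"
  shows "solvable_below k U m c a"
  using assms unfolding solvable_below_def instance_size_def by (simp add: add.commute)

lemma step_positive:
  assumes k: "k \<ge> 2" and R: "rooted k U m a c b {}" and L: "loose k U m a c b"
    and IH: "solvable_below k U m a c" and card: "card U \<ge> 2"
    and pos: "\<And>u. u \<in> U \<Longrightarrow> circ_norm (2 * k) (b u - 1) < circ_norm (2 * k) (b u)
      \<and> \<not> circ_norm (2 * k) (b u + 1) < circ_norm (2 * k) (b u)"
  shows "orientable k U m a c b"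
proof (cases "\<exists>x\<in>U. a x > 0")
  case True
  then show ?thesis using step_absorb[OF _ R L IH] pos k by fastforce
next
  case False
  note D = rootedD[OF R]
  have a0: "sum a U = 0" using False D(4) by (intro sum.neutral) force
  obtain v where v: "v \<in> U" using card by fastforce
  have "{v} \<noteq> U" using card by force
  then obtain x y where "x \<in> U" "y \<in> U" "x \<noteq> y" "m x y > 0"
    using rooted_connected[OF k R, of "{v}"] v by auto
  then show ?thesis using step_pad[OF _ R L IH _ _ _ _ a0] pos k by auto
qed

text \<open>When no edge can be oriented by \<open>step_orient_edge\<close>, the ends of an edge gain in the same single
  direction. The set \<open>P\<close> of vertices that gain only by sending out is therefore a union of components,
  hence empty or everything by \<open>rooted_connected\<close>.\<close>

lemma step_nonzero:
  assumes k: "k \<ge> 2" and R: "rooted k U m a c b {}" and L: "loose k U m a c b"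
    and IH: "solvable_below k U m a c" and card: "card U \<ge> 2"
    and nz: "\<And>u. u \<in> U \<Longrightarrow> \<not> 2 * k dvd b u"
  shows "orientable k U m a c b"
proof (rule ccontr)
  assume no: "\<not> ?thesis"
  note D = rootedD[OF R]
  have k0: "k > 0" and n: "2 * k > 0" using k by simp_all
  define dn where "dn u \<longleftrightarrow> circ_norm (2 * k) (b u - 1) < circ_norm (2 * k) (b u)" for u
  define up where "up u \<longleftrightarrow> circ_norm (2 * k) (b u + 1) < circ_norm (2 * k) (b u)" for u
  have some: "dn u \<or> up u" if "u \<in> U" for u
    using circ_norm_moves[OF n nz[OF that]] by (simp add: dn_def up_def)
  have no_edge: "\<not> (dn x \<and> up y)" if "x \<in> U" "y \<in> U" "x \<noteq> y" "m x y > 0" for x y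
    using step_orient_edge[OF k0 R L IH that] no by (auto simp: dn_def up_def)
  define P where "P = {u \<in> U. dn u \<and> \<not> up u}"
  have edge: "x \<in> P \<longleftrightarrow> y \<in> P" if "x \<in> U" "y \<in> U" "x \<noteq> y" "m x y > 0" for x y
    using no_edge[OF that] no_edge[of y x] that D(3)[OF that(1,2)] some[of x] some[of y]
    by (auto simp: P_def)
  have "P \<noteq> U"
    using step_positive[OF k R L IH card] no by (auto simp: P_def dn_def up_def)
  moreover have "P \<subseteq> U" by (auto simp: P_def)
  ultimately have "P = {}"
    using rooted_connected[OF k R, of P] edge by (metis DiffD1 DiffD2 Diff_eq_empty_iff subset_antisym subsetD)
  have neg: "up u \<and> \<not> dn u" if u: "u \<in> U" for u
  proof -
    have "{u} \<noteq> U" using card by force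
    then obtain y where y: "y \<in> U" "y \<noteq> u" "m u y > 0"
      using rooted_connected[OF k R, of "{u}"] u by auto
    then show ?thesis
      using no_edge[of u y] no_edge[of y u] D(3)[OF u y(1)] u some[of u] some[of y] \<open>P = {}\<close>
      by (auto simp: P_def)
  qed
  have "circ_norm (2 * k) (- b u - 1) < circ_norm (2 * k) (- b u)
      \<and> \<not> circ_norm (2 * k) (- b u + 1) < circ_norm (2 * k) (- b u)" if "u \<in> U" for u
  proof -
    have e: "- b u - 1 = - (b u + 1)" "- b u + 1 = - (b u - 1)" by simp_all
    show ?thesis using neg[OF that] unfolding e circ_norm_minus[OF n] dn_def up_def .
  qed
  then have "orientable k U m c a (\<lambda>u. - b u)"
    using step_positive[OF k rooted_negate[OF k0 R] loose_negate[OF k0 L] solvable_below_swap[OF IH] card]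
    by blast
  then show False using orientable_negate no by blast
qed

section \<open>Removing a vertex with vanishing target\<close>

text \<open>Lifting the path from \<open>y\<close> through \<open>v\<close> to the root: an arc from \<open>v\<close> to the root is moved to \<open>y\<close> in
  exchange for an edge \<open>vy\<close>. Only sets that contain \<open>v\<close> but not \<open>y\<close> lose boundary edges, and the
  singleton of \<open>v\<close> is exempt.\<close>

lemma step_lift_root:
  assumes k: "k > 0" and R: "rooted k U m a c b {v}" and L: "loose k U m a c b"
    and IH: "solvable_below k U m a c" and vy: "v \<in> U" "y \<in> U" "v \<noteq> y" "m v y > 0"
    and av: "a v > 0"
  shows "orientable k U m a c b"
proof -
  note D = rootedD[OF R]
  have n: "2 * k > 0" using k by simp
  let ?m = "\<lambda>u w. m u w + (-1) * edge v y u w"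
  let ?a = "a(v := a v + (-1), y := a y + 1)"
  have sa: "sum ?a A = sum a A + (if v \<in> A then -1 else 0) + (if y \<in> A then 1 else 0)"
    if "A \<subseteq> U" for A
    using sum_fun_upd_add2[OF finite_subset[OF that D(1)] vy(3)] .
  have saU: "sum ?a U = sum a U" using sa[of U] vy by simp
  have bd: "bdry U ?m ?a c A = bdry U m a c A + (if v \<in> A \<and> y \<notin> A then -2 else 0)"
    if "A \<subseteq> U" for A
    unfolding bdry_def cut_add_edge[OF D(1) that vy(1,2)] sa[OF that] by simp
  have nn: "0 \<le> ?m u w" if "u \<in> U" "w \<in> U" for u w
    using D(2)[OF that] vy(3,4) D(3)[OF vy(1,2)] by (auto simp: edge_def arc_def)
  have "rooted k U ?m ?a c b {v}"
  proof (rule rootedI)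
    show "?m u w = ?m w u" if "u \<in> U" "w \<in> U" for u w
      using D(3)[OF that] edge_commute[of v y u w] by simp
    show "2 * k dvd sum ?a U - sum c U - sum b U" using D(6) unfolding saU .
    show "sum ?a U + sum c U \<le> 2 * k - 2 + circ_norm (2 * k) (sum ?a U - sum c U)"
      using D(7) unfolding saU .
    show "even (bdry U ?m ?a c A + sum b A)" if A: "A \<subseteq> U" for A
      using D(8)[OF A] unfolding bd[OF A] by auto
    show "2 * k - 2 + circ_norm (2 * k) (sum b A) \<le> bdry U ?m ?a c A"
      if A: "A \<subseteq> U" "A \<noteq> {}" "A \<noteq> U" "A \<noteq> {v}" for A
    proof (rule singleton_or_big[OF D(1) A(1,2)])
      fix u assume "u \<in> U" "A = {u}"
      then show ?thesis using D(9)[OF A] A(4) unfolding bd[OF A(1)] by auto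
    next
      assume "2 \<le> card A"
      then have "2 * k + circ_norm (2 * k) (sum b A) \<le> bdry U m a c A"
        using L A unfolding loose_def by blast
      then show ?thesis unfolding bd[OF A(1)] by auto
    qed
  qed (use D nn av in auto)
  moreover have "(instance_size U ?m ?a c, instance_size U m a c) \<in> size_order"
    by (rule smaller_edges) (use nn total_add_edge[OF D(1) vy(1,2), of m "-1"] in auto)
  ultimately have "orientable k U ?m ?a c b" using solvable_belowD[OF IH] by blast
  then have "orientable k U ?m a c (b(v := b v + 1, y := b y + (-1)))"
    by (rule orientable_cong) (use vy(3) in auto)
  then have "orientable k U (\<lambda>u w. m u w + (-1) * edge y v u w) a c (b(y := b y + (-1), v := b v + 1))"
    using vy(3) by (simp add: fun_upd_twist edge_def add.commute)
  then show ?thesis by (rule orientable_orient_edge[OF D(1) vy(2,1) vy(3)[symmetric]])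
qed

text \<open>Lifting the path \<open>x, v, y\<close> keeps all targets and affects only the boundaries that separate \<open>v\<close>
  from both \<open>x\<close> and \<open>y\<close>. As \<open>{v}\<close> is exempt, such a set has at least two elements, and two edges to spare.\<close>

lemma step_lift:
  assumes k: "k > 0" and R: "rooted k U m a c b {v}" and L: "loose k U m a c b"
    and IH: "solvable_below k U m a c"
    and xy: "v \<in> U" "x \<in> U" "y \<in> U" "x \<noteq> v" "y \<noteq> v" "x \<noteq> y" "m v x > 0" "m v y > 0"
  shows "orientable k U m a c b"
proof -
  note D = rootedD[OF R]
  have n: "2 * k > 0" using k by simp
  let ?m = "\<lambda>u w. m u w + (-1) * edge x v u w + (-1) * edge v y u w + 1 * edge x y u w"
  have bd: "bdry U ?m a c A = bdry U m a c A
      + (if (v \<in> A) \<noteq> (x \<in> A) \<and> (v \<in> A) \<noteq> (y \<in> A) then -2 else 0)"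
    if "A \<subseteq> U" for A
    unfolding bdry_def cut_add_edge[OF D(1) that xy(2,3)] cut_add_edge[OF D(1) that xy(1,3)]
      cut_add_edge[OF D(1) that xy(2,1)] by auto
  have nn: "0 \<le> ?m u w" if "u \<in> U" "w \<in> U" for u w
    using D(2)[OF that] xy D(3)[OF xy(1,2)] D(3)[OF xy(1,3)] by (auto simp: edge_def arc_def)
  have "rooted k U ?m a c b {v}"
  proof (rule rootedI)
    show "?m u w = ?m w u" if "u \<in> U" "w \<in> U" for u w
      using D(3)[OF that] edge_commute[of _ _ u w] by simp
    show "even (bdry U ?m a c A + sum b A)" if A: "A \<subseteq> U" for A
      using D(8)[OF A] unfolding bd[OF A] by auto
    show "2 * k - 2 + circ_norm (2 * k) (sum b A) \<le> bdry U ?m a c A"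
      if A: "A \<subseteq> U" "A \<noteq> {}" "A \<noteq> U" "A \<noteq> {v}" for A
    proof (rule singleton_or_big[OF D(1) A(1,2)])
      fix u assume "u \<in> U" "A = {u}"
      then show ?thesis using D(9)[OF A] A(4) xy unfolding bd[OF A(1)] by auto
    next
      assume "2 \<le> card A"
      then have "2 * k + circ_norm (2 * k) (sum b A) \<le> bdry U m a c A"
        using L A unfolding loose_def by blast
      then show ?thesis unfolding bd[OF A(1)] by auto
    qed
  qed (use D nn in auto)
  moreover have "(instance_size U ?m a c, instance_size U m a c) \<in> size_order"
  proof (rule smaller_edges)
    show "(\<Sum>u\<in>U. \<Sum>w\<in>U. ?m u w) < (\<Sum>u\<in>U. \<Sum>w\<in>U. m u w)"
      unfolding total_add_edge[OF D(1) xy(2,3)] total_add_edge[OF D(1) xy(1,3)]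
      total_add_edge[OF D(1) xy(2,1)] by simp
  qed (fact nn)
  ultimately have O: "orientable k U ?m a c b" using solvable_belowD[OF IH] by blast
  show ?thesis
    by (rule orientable_lift[OF D(1) xy(2,3,1) xy(6,4,5) D(2)[OF xy(2,3)] _ O]) (rule D(3))
qed

text \<open>If all edges at \<open>v\<close> lead to \<open>x\<close>, orienting half of them in each direction meets the target \<open>0\<close>
  (their number is even by parity) without influence on \<open>x\<close>. After deletion of \<open>v\<close>, a set that contains
  \<open>x\<close> has the boundary that it had together with \<open>v\<close> before.\<close>

lemma step_delete:
  assumes k: "k > 0" and R: "rooted k U m a c b {v}"
    and IH: "solvable_below k U m a c" and v: "v \<in> U" "a v = 0" "c v = 0"
    and one: "\<And>u. u \<in> U \<Longrightarrow> u \<noteq> v \<Longrightarrow> u \<noteq> x \<Longrightarrow> m v u = 0"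
  shows "orientable k U m a c b"
proof -
  note D = rootedD[OF R]
  have n: "2 * k > 0" using k by simp
  define W where "W = U - {v}"
  have W: "finite W" "v \<notin> W" "insert v W = U" "W \<subseteq> U" using v(1) D(1) by (auto simp: W_def)
  have bv: "2 * k dvd b v" using D(10) by blast
  have ins: "sum h U = h v + sum h W" for h :: "'a \<Rightarrow> int"
    using W by (metis sum.insert)
  have mv: "m u v = m v u" if "u \<in> U" for u using D(3) that v(1) by blast
  have cut: "cut U m A = cut W m A" if A: "A \<subseteq> W" "x \<notin> A" for A
  proof -
    have "U - A = insert v (W - A)" "finite (W - A)" "v \<notin> W - A" using W A by auto
    then have "cut U m A = (\<Sum>u\<in>A. m u v + (\<Sum>w\<in>W - A. m u w))" by (simp add: cut_def)
    also have "\<dots> = cut W m A"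
      unfolding cut_def
    proof (rule sum.cong[OF refl])
      fix u assume "u \<in> A"
      then have "u \<in> U" "u \<noteq> v" "u \<noteq> x" using A W(2,4) by auto
      then have "m u v = 0" using mv[of u] one[of u] by simp
      then show "m u v + (\<Sum>w\<in>W - A. m u w) = (\<Sum>w\<in>W - A. m u w)" by simp
    qed
    finally show ?thesis .
  qed
  have cut': "cut U m (insert v A) = cut W m A" if A: "A \<subseteq> W" "x \<in> A" for A
  proof -
    have f: "finite A" "v \<notin> A" using W A finite_subset by auto
    have "U - insert v A = W - A" using W A by auto
    moreover have "(\<Sum>w\<in>W - A. m v w) = 0"
      by (rule sum.neutral) (use A W one in auto)
    ultimately show ?thesis using f by (simp add: cut_def)
  qed
  have "rooted k W m a c b {}"
  proof (rule rootedI)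
    show "2 * k dvd sum a W - sum c W - sum b W"
    proof -
      have "sum a W - sum c W - sum b W = (sum a U - sum c U - sum b U) + b v"
        using ins[of a] ins[of c] ins[of b] v by simp
      then show ?thesis using D(6) bv by (metis dvd_add)
    qed
    show "sum a W + sum c W \<le> 2 * k - 2 + circ_norm (2 * k) (sum a W - sum c W)"
      using D(7) v by (simp add: ins)
    show "even (bdry W m a c A + sum b A)" if A: "A \<subseteq> W" for A
    proof (cases "x \<in> A")
      case True
      have "finite A" "v \<notin> A" using A W finite_subset by auto
      moreover have "even (b v)" using bv dvd_mult_left by blast
      ultimately show ?thesis using D(8)[of "insert v A"] A W v cut'[OF A True]
        by (simp add: bdry_def)
    next
      case False
      then show ?thesis using D(8)[of A] A W cut[OF A False] by (auto simp: bdry_def)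
    qed
    show "2 * k - 2 + circ_norm (2 * k) (sum b A) \<le> bdry W m a c A"
      if A: "A \<subseteq> W" "A \<noteq> {}" "A \<noteq> W" "A \<noteq> {}" for A
    proof (cases "x \<in> A")
      case True
      have f: "finite A" "v \<notin> A" using A W finite_subset by auto
      have "circ_norm (2 * k) (b v + sum b A) = circ_norm (2 * k) (sum b A)"
        by (rule circ_norm_cong) (use bv in simp)
      moreover have "insert v A \<subseteq> U" "insert v A \<noteq> U" "insert v A \<noteq> {v}"
        using A W f by auto
      ultimately show ?thesis using D(9)[of "insert v A"] f v cut'[OF A(1) True]
        by (simp add: bdry_def)
    next
      case False
      have "A \<subseteq> U" "A \<noteq> U" "A \<noteq> {v}" using A W by auto
      then show ?thesis using D(9)[of A] A W cut[OF A(1) False] by (auto simp: bdry_def)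
    qed
  qed (use D W in auto)
  moreover have "card W < card U" unfolding W_def by (rule card_Diff1_less[OF D(1) v(1)])
  ultimately have "orientable k W m a c b" using solvable_belowD[OF IH] smaller_vertices by blast
  then obtain f where f: "\<And>u w. u \<in> W \<Longrightarrow> w \<in> W \<Longrightarrow> u \<noteq> w \<Longrightarrow> 0 \<le> f u w \<and> f u w + f w u = m u w"
    and nf: "\<And>u. u \<in> W \<Longrightarrow> 2 * k dvd net W f u + a u - c u - b u"
    unfolding orientable_def by metis
  have ev: "even (m v u)" if u: "u \<in> W" for u
  proof (cases "u = x")
    case True
    have "(\<Sum>w\<in>W. m v w) = m v x + (\<Sum>w\<in>W - {x}. m v w)"
      using u True W(1) by (simp add: sum.remove)
    also have "(\<Sum>w\<in>W - {x}. m v w) = 0"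
      by (rule sum.neutral) (use W one in auto)
    finally have "bdry U m a c {v} = m v x" using v by (simp add: bdry_def cut_def W_def)
    moreover have "even (b v)" using bv dvd_mult_left by blast
    ultimately show ?thesis using D(8)[of "{v}"] v(1) True by simp
  next
    case False
    moreover have "u \<in> U" "u \<noteq> v" using u by (auto simp: W_def)
    ultimately show ?thesis using one[of u] by simp
  qed
  \<comment> \<open>Of the edges between \<open>v\<close> and \<open>x\<close>, one half is oriented in each direction.\<close>
  let ?f = "\<lambda>u w. if u = v \<or> w = v then m u w div 2 else f u w"
  have netW: "net U ?f u = net W f u" if u: "u \<in> W" for u
  proof -
    have "(\<Sum>w\<in>W. ?f u w - ?f w u) = (\<Sum>w\<in>W. f u w - f w u)"
      by (rule sum.cong) (use W u in auto)
    then show ?thesis using mv[of u] u W by (auto simp: net_def ins)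
  qed
  have netv: "net U ?f v = 0"
    unfolding net_def by (rule sum.neutral) (use mv in auto)
  have "2 * k dvd net U ?f u + a u - c u - b u" if "u \<in> U" for u
    using that netW netv nf bv v W by (cases "u = v") auto
  moreover have "0 \<le> ?f u w \<and> ?f u w + ?f w u = m u w" if "u \<in> U" "w \<in> U" "u \<noteq> w" for u w
  proof (cases "u = v \<or> w = v")
    case True
    then have "even (m u w)" using ev[of u] ev[of w] mv[of u] that W by auto
    then show ?thesis using True D(2)[OF that(1,2)] D(3)[OF that(1,2)] by auto
  next
    case False
    then show ?thesis using f[of u w] that W by auto
  qed
  ultimately show ?thesis unfolding orientable_def by (intro exI[of _ ?f]) blast
qed

text \<open>As long as \<open>v\<close> has two distinct neighbours, the root included, a pair of its edges is lifted.
  With a single neighbour other than the root, \<open>v\<close> is deleted. If the root were its only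
  neighbour, the remaining vertices would send out more edges than the root has.\<close>

lemma step_zero:
  assumes k: "k \<ge> 2" and R: "rooted k U m a c b {v}" and L: "loose k U m a c b"
    and IH: "solvable_below k U m a c" and card: "card U \<ge> 2"
  shows "orientable k U m a c b"
proof -
  note D = rootedD[OF R]
  have k0: "k > 0" using k by simp
  have v: "v \<in> U" using D(10) by auto
  define N where "N = {u \<in> U. u \<noteq> v \<and> m v u > 0}"
  consider (two) x y where "x \<in> N" "y \<in> N" "x \<noteq> y" | (one) x where "N = {x}" | (none) "N = {}"
    by blast
  then show ?thesis
  proof cases
    case two
    then show ?thesis using step_lift[OF k0 R L IH v, of x y] by (auto simp: N_def)
  next
    case one
    then have x: "x \<in> U" "v \<noteq> x" "m v x > 0" by (auto simp: N_def)
    show ?thesis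
    proof (cases "a v > 0 \<or> c v > 0")
      case True
      have "rooted k U m c a (\<lambda>u. - b u) {v}" by (rule rooted_negate[OF k0 R])
      then have "orientable k U m c a (\<lambda>u. - b u)" if "c v > 0"
        using step_lift_root[OF k0 _ loose_negate[OF k0 L] solvable_below_swap[OF IH] v x] that
        by blast
      then show ?thesis
        using True step_lift_root[OF k0 R L IH v x] orientable_negate by blast
    next
      case False
      then have "a v = 0" "c v = 0" using D(4,5)[OF v] by auto
      then show ?thesis
      proof (rule step_delete[OF k0 R IH v, where x = x])
        fix u assume "u \<in> U" "u \<noteq> v" "u \<noteq> x"
        then show "m v u = 0" using one D(2)[OF v] by (force simp: N_def)
      qed
    qed
  next
    case none
    have z: "m v u = 0" "m u v = 0" if "u \<in> U" "u \<noteq> v" for u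
      using none that D(2)[OF v, of u] D(3)[OF v, of u] by (auto simp: N_def)
    define A where "A = U - {v}"
    have "U \<noteq> {v}" using card by auto
    then have A: "A \<subseteq> U" "A \<noteq> {}" "A \<noteq> U" "A \<noteq> {v}" "U - A = {v}"
      using v by (auto simp: A_def)
    have "cut U m A = 0" using z by (auto simp: cut_def A(5)) (auto simp: A_def)
    then have "2 * k - 2 + circ_norm (2 * k) (sum b A) \<le> sum a A + sum c A"
      using D(9)[OF A(1-4)] by (simp add: bdry_def)
    moreover have "circ_norm (2 * k) (sum a U - sum c U) = circ_norm (2 * k) (sum b A)"
    proof (rule circ_norm_cong)
      have "sum a U - sum c U - sum b A = (sum a U - sum c U - sum b U) + b v"
        using sum_split[OF D(1) A(1), of b] A(5) by simp
      moreover have "2 * k dvd b v" using D(10) by auto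
      ultimately show "2 * k dvd sum a U - sum c U - sum b A" using D(6) by (metis dvd_add)
    qed
    ultimately have "a v + c v \<le> 0"
      using D(7) sum_split[OF D(1) A(1), of a] sum_split[OF D(1) A(1), of c] A(5) by simp
    then have "a v = 0" "c v = 0" using D(4,5)[OF v] by auto
    then show ?thesis using step_delete[OF k0 R IH v, where x = v] z by blast
  qed
qed

section \<open>Contracting a tight set\<close>

lemma distribute_sum:
  fixes m :: "'a \<Rightarrow> int"
  assumes "finite A" "\<And>x. x \<in> A \<Longrightarrow> 0 \<le> m x" "0 \<le> s" "s \<le> sum m A"
  shows "\<exists>h. (\<forall>x\<in>A. 0 \<le> h x \<and> h x \<le> m x) \<and> sum h A = s"
  using assms
proof (induction A arbitrary: s rule: finite_induct)
  case empty
  then show ?case by auto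
next
  case (insert y A)
  define t where "t = min s (m y)"
  have "0 \<le> sum m A" using insert.prems by (intro sum_nonneg) auto
  then have "\<exists>h. (\<forall>x\<in>A. 0 \<le> h x \<and> h x \<le> m x) \<and> sum h A = s - t"
    using insert.prems insert.hyps by (intro insert.IH) (auto simp: t_def min_def)
  then obtain h where h: "\<forall>x\<in>A. 0 \<le> h x \<and> h x \<le> m x" "sum h A = s - t" by blast
  have "sum (h(y := t)) (insert y A) = s"
  proof -
    have "sum (h(y := t)) A = sum h A" by (rule sum.cong) (use insert.hyps in auto)
    then show ?thesis using h(2) insert.hyps by simp
  qed
  moreover have "0 \<le> (h(y := t)) x \<and> (h(y := t)) x \<le> m x" if "x \<in> insert y A" for x
    using h(1) insert.prems that by (auto simp: t_def)
  ultimately show ?case by blast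
qed

text \<open>Contraction of \<open>A\<close> onto its element \<open>p\<close>: a subset \<open>B\<close> of the contracted vertex set stands for
  \<open>B \<union> A\<close> or \<open>B\<close>, according to whether it contains \<open>p\<close>.\<close>

lemma sum_contract:
  fixes h :: "'v \<Rightarrow> int"
  assumes "finite U" "A \<subseteq> U" "p \<in> A" "B \<subseteq> insert p (U - A)"
  shows "(\<Sum>u\<in>B. if u = p then sum h A else h u) = sum h (if p \<in> B then B \<union> A else B)"
proof (cases "p \<in> B")
  case True
  have f: "finite A" "finite B" using assms finite_subset[OF _ assms(1)] finite_subset[OF assms(4)] by auto
  have "(\<Sum>u\<in>B. if u = p then sum h A else h u) = sum h A + (\<Sum>u\<in>B - {p}. if u = p then sum h A else h u)"
    using True f by (simp add: sum.remove)
  also have "(\<Sum>u\<in>B - {p}. if u = p then sum h A else h u) = sum h (B - {p})"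
    by (rule sum.cong) auto
  also have "sum h A + sum h (B - {p}) = sum h (A \<union> (B - {p}))"
    by (rule sum.union_disjoint[symmetric]) (use f assms in auto)
  also have "A \<union> (B - {p}) = B \<union> A" using assms by auto
  finally show ?thesis using True by simp
next
  case False
  then have "(\<Sum>u\<in>B. if u = p then sum h A else h u) = sum h B"
    by (intro sum.cong) auto
  then show ?thesis using False by simp
qed

definition contract :: "'v set \<Rightarrow> 'v \<Rightarrow> ('v \<Rightarrow> 'v \<Rightarrow> int) \<Rightarrow> 'v \<Rightarrow> 'v \<Rightarrow> int" where
  "contract A p m u w = (if u = p then if w = p then 0 else (\<Sum>x\<in>A. m x w)
     else if w = p then (\<Sum>x\<in>A. m u x) else m u w)"

lemma cut_contract:
  assumes U: "finite U" "A \<subseteq> U" "p \<in> A" and B: "B \<subseteq> insert p (U - A)"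
  shows "cut (insert p (U - A)) (contract A p m) B = cut U m (if p \<in> B then B \<union> A else B)"
proof (cases "p \<in> B")
  case True
  define C where "C = U - (B \<union> A)"
  have C: "insert p (U - A) - B = C" "p \<notin> C" using True U B by (auto simp: C_def)
  have "cut (insert p (U - A)) (contract A p m) B = (\<Sum>w\<in>C. \<Sum>u\<in>B. contract A p m u w)"
    unfolding cut_def C(1) by (rule sum.swap)
  also have "\<dots> = (\<Sum>w\<in>C. \<Sum>u\<in>B \<union> A. m u w)"
  proof (rule sum.cong[OF refl])
    fix w assume "w \<in> C"
    then have "w \<noteq> p" using C by auto
    then have "(\<Sum>u\<in>B. contract A p m u w) = (\<Sum>u\<in>B. if u = p then (\<Sum>x\<in>A. m x w) else m u w)"
      by (intro sum.cong) (auto simp: contract_def)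
    then show "(\<Sum>u\<in>B. contract A p m u w) = (\<Sum>u\<in>B \<union> A. m u w)"
      using sum_contract[OF U B, of "\<lambda>u. m u w"] True by simp
  qed
  also have "\<dots> = cut U m (B \<union> A)" unfolding cut_def C_def by (rule sum.swap)
  finally show ?thesis using True by simp
next
  case False
  define C where "C = insert p (U - A) - B"
  have C: "C \<subseteq> insert p (U - A)" "p \<in> C" "C \<union> A = U - B" using False U B by (auto simp: C_def)
  have "(\<Sum>w\<in>C. contract A p m u w) = (\<Sum>w\<in>U - B. m u w)" if "u \<in> B" for u
  proof -
    have "u \<noteq> p" using that False by auto
    then have "(\<Sum>w\<in>C. contract A p m u w) = (\<Sum>w\<in>C. if w = p then (\<Sum>x\<in>A. m u x) else m u w)"
      by (simp add: contract_def)
    then show ?thesis using sum_contract[OF U C(1), of "m u"] C(2,3) by simp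
  qed
  then show ?thesis using False by (simp add: cut_def flip: C_def)
qed

lemma rooted_contract:
  assumes R: "rooted k U m a c b X" and A: "A \<subseteq> U" "p \<in> A" "2 \<le> card A"
  shows "rooted k (insert p (U - A)) (contract A p m) (\<lambda>u. if u = p then sum a A else a u)
    (\<lambda>u. if u = p then sum c A else c u) (\<lambda>u. if u = p then sum b A else b u)
    (if X \<subseteq> U - A then X else {})"
proof -
  note D = rootedD[OF R]
  let ?U = "insert p (U - A)" and ?m = "contract A p m"
  let ?cl = "\<lambda>h :: 'a \<Rightarrow> int. \<lambda>u. if u = p then sum h A else h u"
  let ?L = "\<lambda>B. if p \<in> B then B \<union> A else B"
  have L: "?L B \<subseteq> U" if "B \<subseteq> ?U" for B using that A by auto
  have LU: "?L ?U = U" using A by auto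
  have s: "sum (?cl h) B = sum h (?L B)" if "B \<subseteq> ?U" for B h
    by (rule sum_contract[OF D(1) A(1,2) that])
  have sU: "sum (?cl h) ?U = sum h U" for h using s[of ?U h] unfolding LU by simp
  have bd: "bdry ?U ?m (?cl a) (?cl c) B = bdry U m a c (?L B)" if "B \<subseteq> ?U" for B
    unfolding bdry_def s[OF that] cut_contract[OF D(1) A(1,2) that] ..
  have nn: "0 \<le> sum h A" if "\<And>u. u \<in> U \<Longrightarrow> 0 \<le> h u" for h :: "'a \<Rightarrow> int"
    using that A by (intro sum_nonneg) auto
  show ?thesis
  proof (rule rootedI)
    show "0 \<le> ?m u w" if "u \<in> ?U" "w \<in> ?U" for u w
      using that A D(2) by (auto simp: contract_def intro!: sum_nonneg)
    show "?m u w = ?m w u" if "u \<in> ?U" "w \<in> ?U" for u w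
    proof -
      have "(\<Sum>x\<in>A. m x y) = (\<Sum>x\<in>A. m y x)" if "y \<in> U" for y
        by (rule sum.cong[OF refl]) (use D(3) A that in blast)
      then show ?thesis using that A D(3)[of u w] by (auto simp: contract_def)
    qed
    show "0 \<le> ?cl a u" "0 \<le> ?cl c u" if "u \<in> ?U" for u
      using that nn D(4,5) by auto
    show "2 * k dvd sum (?cl a) ?U - sum (?cl c) ?U - sum (?cl b) ?U"
      unfolding sU by (rule D(6))
    show "sum (?cl a) ?U + sum (?cl c) ?U
        \<le> 2 * k - 2 + circ_norm (2 * k) (sum (?cl a) ?U - sum (?cl c) ?U)"
      unfolding sU by (rule D(7))
    show "even (bdry ?U ?m (?cl a) (?cl c) B + sum (?cl b) B)" if "B \<subseteq> ?U" for B
      unfolding bd[OF that] s[OF that] by (rule D(8)[OF L[OF that]])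
    show "2 * k - 2 + circ_norm (2 * k) (sum (?cl b) B) \<le> bdry ?U ?m (?cl a) (?cl c) B"
      if B: "B \<subseteq> ?U" "B \<noteq> {}" "B \<noteq> ?U" "B \<noteq> (if X \<subseteq> U - A then X else {})" for B
      unfolding bd[OF B(1)] s[OF B(1)]
    proof (rule D(9)[OF L[OF B(1)]])
      show "?L B \<noteq> {}" using B(2) by auto
      show "?L B \<noteq> U" using B A by auto
      show "?L B \<noteq> X"
      proof (cases "p \<in> B")
        case True
        have "\<not> A \<subseteq> {v}" for v
        proof
          assume "A \<subseteq> {v}"
          then have "card A \<le> card {v}" by (intro card_mono) auto
          then show False using A(3) by simp
        qed
        then show ?thesis using True D(10) by (metis B(2) Un_empty sup_ge2)
      next
        case False
        then have "B \<subseteq> U - A" using B(1) by blast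
        then show ?thesis using False B(4) by (auto split: if_splits)
      qed
    qed
    show "(if X \<subseteq> U - A then X else {}) = {} \<or>
      (\<exists>v\<in>?U. (if X \<subseteq> U - A then X else {}) = {v} \<and> 2 * k dvd ?cl b v)"
      using D(10) A(2) by auto
  qed (use D(1) in auto)
qed

text \<open>First \<open>A\<close> is contracted to a point and the result is oriented. The arcs that it assigns to the
  boundary of \<open>A\<close> are distributed over the actual ends in \<open>A\<close>. Then everything outside \<open>A\<close> becomes the
  root of a second instance on \<open>A\<close>, with these arcs as the root arcs; its root satisfies the degree
  bound because \<open>A\<close> is tight. Both orientations agree on the boundary and fit together.\<close>

lemma step_contract:
  assumes k: "k > 0" and R: "rooted k U m a c b X" and IH: "solvable_below k U m a c"
    and A: "A \<subseteq> U" "2 \<le> card A" "A \<noteq> U"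
    and tight: "bdry U m a c A \<le> 2 * k - 2 + circ_norm (2 * k) (sum b A)"
  shows "orientable k U m a c b"
proof -
  note D = rootedD[OF R]
  have n: "2 * k > 0" using k by simp
  have fA: "finite A" "finite (U - A)" using A(1) D(1) finite_subset by auto
  have "A \<noteq> {}" using A(2) by auto
  then obtain p where p: "p \<in> A" by blast
  let ?U = "insert p (U - A)" and ?m = "contract A p m"
  have "card (U - A) = card U - card A" by (rule card_Diff_subset[OF fA(1) A(1)])
  moreover have "card A \<le> card U" by (rule card_mono[OF D(1) A(1)])
  ultimately have "card ?U < card U" using A(2) fA p by simp
  then have "orientable k ?U ?m (\<lambda>u. if u = p then sum a A else a u)
    (\<lambda>u. if u = p then sum c A else c u) (\<lambda>u. if u = p then sum b A else b u)"
    using solvable_belowD[OF IH rooted_contract[OF R A(1) p A(2)]] smaller_vertices by blast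
  then obtain f where f: "\<And>u w. u \<in> ?U \<Longrightarrow> w \<in> ?U \<Longrightarrow> u \<noteq> w \<Longrightarrow> 0 \<le> f u w \<and> f u w + f w u = ?m u w"
    and nf: "\<And>u. u \<in> ?U \<Longrightarrow> 2 * k dvd net ?U f u + (if u = p then sum a A else a u)
      - (if u = p then sum c A else c u) - (if u = p then sum b A else b u)"
    unfolding orientable_def by metis
  have "\<exists>h. (\<forall>x\<in>A. 0 \<le> h x \<and> h x \<le> m x w) \<and> sum h A = f p w" if w: "w \<in> U - A" for w
  proof (rule distribute_sum[OF fA(1)])
    show "0 \<le> m x w" if "x \<in> A" for x using D(2) that w A(1) by blast
    have "p \<noteq> w" using p w by auto
    then show "0 \<le> f p w" "f p w \<le> (\<Sum>x\<in>A. m x w)"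
      using f[of p w] f[of w p] w by (auto simp: contract_def)
  qed
  then obtain H where H: "\<And>w x. w \<in> U - A \<Longrightarrow> x \<in> A \<Longrightarrow> 0 \<le> H w x \<and> H w x \<le> m x w"
    and sH: "\<And>w. w \<in> U - A \<Longrightarrow> sum (H w) A = f p w"
    by metis
  have sH': "(\<Sum>x\<in>A. m x w - H w x) = f w p" if w: "w \<in> U - A" for w
  proof -
    have "p \<noteq> w" using p w by auto
    then show ?thesis using sH[OF w] f[of p w] w by (simp add: sum_subtractf contract_def)
  qed
  \<comment> \<open>The arcs that now join \<open>u\<close> to the outside of \<open>A\<close>, old root arcs included.\<close>
  define a' where "a' u = a u + (\<Sum>w\<in>U - A. H w u)" for u
  define c' where "c' u = c u + (\<Sum>w\<in>U - A. m u w - H w u)" for u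
  have bd: "bdry A m a' c' B = bdry U m a c B" if B: "B \<subseteq> A" for B
  proof -
    have "(\<Sum>w\<in>U - B. m u w) = (\<Sum>w\<in>A - B. m u w) + (\<Sum>w\<in>U - A. m u w)" for u
    proof -
      have "U - B = (A - B) \<union> (U - A)" using A(1) B by blast
      then show ?thesis
        by (simp only:) (rule sum.union_disjoint, use fA in auto)
    qed
    moreover have "sum a' B + sum c' B = sum a B + sum c B + (\<Sum>u\<in>B. \<Sum>w\<in>U - A. m u w)"
      by (simp add: a'_def c'_def sum.distrib sum_subtractf)
    ultimately show ?thesis by (simp add: bdry_def cut_def sum.distrib)
  qed
  have sa: "sum a' A - sum c' A = net ?U f p + sum a A - sum c A"
  proof -
    have "(\<Sum>u\<in>A. \<Sum>w\<in>U - A. H w u) = (\<Sum>w\<in>U - A. f p w)"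
      by (subst sum.swap) (simp add: sH)
    moreover have "(\<Sum>u\<in>A. \<Sum>w\<in>U - A. m u w - H w u) = (\<Sum>w\<in>U - A. f w p)"
      by (subst sum.swap) (simp add: sH')
    moreover have "net ?U f p = (\<Sum>w\<in>U - A. f p w) - (\<Sum>w\<in>U - A. f w p)"
      using fA p by (simp add: net_def sum_subtractf)
    ultimately show ?thesis by (simp add: a'_def c'_def sum.distrib)
  qed
  have dv: "2 * k dvd sum a' A - sum c' A - sum b A"
    unfolding sa using nf[of p] by simp
  have "rooted k A m a' c' b (if X \<subseteq> A then X else {})"
  proof (rule rootedI)
    show "0 \<le> m u w" "m u w = m w u" if "u \<in> A" "w \<in> A" for u w
      using D(2,3) that A(1) by blast+
    show "0 \<le> a' u" "0 \<le> c' u" if "u \<in> A" for u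
      using that A(1) D(4,5) H by (auto simp: a'_def c'_def intro!: add_nonneg_nonneg sum_nonneg)
    show "sum a' A + sum c' A \<le> 2 * k - 2 + circ_norm (2 * k) (sum a' A - sum c' A)"
      using tight bd[of A] circ_norm_cong[OF dv] by (simp add: bdry_def cut_def)
    show "even (bdry A m a' c' B + sum b B)" if "B \<subseteq> A" for B
      using D(8) that A(1) by (simp add: bd[OF that])
    show "2 * k - 2 + circ_norm (2 * k) (sum b B) \<le> bdry A m a' c' B"
      if B: "B \<subseteq> A" "B \<noteq> {}" "B \<noteq> A" "B \<noteq> (if X \<subseteq> A then X else {})" for B
      unfolding bd[OF B(1)] using B A by (intro D(9)) (auto split: if_splits)
    show "(if X \<subseteq> A then X else {}) = {} \<or> (\<exists>v\<in>A. (if X \<subseteq> A then X else {}) = {v} \<and> 2 * k dvd b v)"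
      using D(10) by auto
  qed (fact fA dv)+
  moreover have "card A < card U" using A D(1) by (simp add: psubset_card_mono psubsetI)
  ultimately have "orientable k A m a' c' b" using solvable_belowD[OF IH] smaller_vertices by blast
  then obtain g where g: "\<And>u w. u \<in> A \<Longrightarrow> w \<in> A \<Longrightarrow> u \<noteq> w \<Longrightarrow> 0 \<le> g u w \<and> g u w + g w u = m u w"
    and ng: "\<And>u. u \<in> A \<Longrightarrow> 2 * k dvd net A g u + a' u - c' u - b u"
    unfolding orientable_def by metis
  define F where "F u w = (if u \<in> A then if w \<in> A then g u w else H w u
      else if w \<in> A then m w u - H u w else f u w)" for u w
  have split: "net U F u = (\<Sum>w\<in>A. F u w - F w u) + (\<Sum>w\<in>U - A. F u w - F w u)" for u
    unfolding net_def by (rule sum_split[OF D(1) A(1)])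
  have "2 * k dvd net U F u + a u - c u - b u" if u: "u \<in> U" for u
  proof (cases "u \<in> A")
    case True
    have "(\<Sum>w\<in>A. F u w - F w u) = net A g u"
      unfolding net_def by (rule sum.cong) (use True in \<open>auto simp: F_def\<close>)
    moreover have "(\<Sum>w\<in>U - A. F u w - F w u) = (a' u - a u) - (c' u - c u)"
      using True by (simp add: F_def a'_def c'_def sum_subtractf sum_distrib_left)
    ultimately have "net U F u + a u - c u - b u = net A g u + a' u - c' u - b u"
      using split[of u] by simp
    then show ?thesis using ng[OF True] by (simp only:)
  next
    case False
    then have u': "u \<in> U - A" using u by simp
    then have "u \<noteq> p" using p by auto
    have "(\<Sum>w\<in>A. F u w - F w u) = (\<Sum>w\<in>A. m w u - H u w) - sum (H u) A"
      using False by (simp add: F_def sum_subtractf flip: sum_distrib_left)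
    also have "\<dots> = f u p - f p u" using sH[OF u'] sH'[OF u'] by simp
    finally have "net U F u = net ?U f u"
      using split[of u] False fA p by (simp add: net_def F_def)
    then show ?thesis using nf[of u] u' \<open>u \<noteq> p\<close> by simp
  qed
  moreover have "0 \<le> F u w \<and> F u w + F w u = m u w" if "u \<in> U" "w \<in> U" "u \<noteq> w" for u w
    using that f[of u w] g[of u w] H[of u w] H[of w u] D(3)[OF that(1,2)] p
    by (auto simp: F_def contract_def)
  ultimately show ?thesis unfolding orientable_def by blast
qed

section \<open>The orientation theorem for rooted graphs\<close>

text \<open>The induction step distinguishes whether there is a tight set of at least two vertices,
  and otherwise whether there is a vertex with target \<open>0\<close>. If no vertex is exempt yet, such a vertex
  can be exempted, as this only weakens the hypothesis.\<close>

theorem rooted_orientable: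
  assumes k: "k \<ge> 2" and "rooted k U m a c b X"
  shows "orientable k U m a c b"
proof -
  have wf: "wf size_order" unfolding size_order_def by auto
  have "\<forall>U :: 'a set. \<forall>m a c b X. instance_size U m a c = s \<longrightarrow> rooted k U m a c b X \<longrightarrow> orientable k U m a c b" for s
  proof (induction s rule: wf_induct_rule[OF wf])
    case (1 s)
    show ?case
    proof (intro allI impI)
      fix U :: "'a set" and m a c b X
      assume s: "instance_size U m a c = s" and R: "rooted k U m a c b X"
      note D = rootedD[OF R]
      have IH: "solvable_below k U m a c"
        using 1 s unfolding solvable_below_def by blast
      have k0: "k > 0" and n: "2 * k > 0" using k by simp_all
      show "orientable k U m a c b"
      proof (cases "card U \<ge> 2")
        case False
        then have same: "u = w" if "u \<in> U" "w \<in> U" for u w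
          using that D(1) card_le_Suc0_iff_eq[of U] by auto
        have "2 * k dvd net U (\<lambda>u w. 0) u + a u - c u - b u" if "u \<in> U" for u
        proof -
          have "U = {u}" using same that by auto
          then show ?thesis using D(6) by (simp add: net_def)
        qed
        then show ?thesis unfolding orientable_def using same by (intro exI[of _ "\<lambda>u w. 0"]) auto
      next
        case card: True
        show ?thesis
        proof (cases "\<exists>A\<subseteq>U. 2 \<le> card A \<and> A \<noteq> U \<and>
            bdry U m a c A \<le> 2 * k - 2 + circ_norm (2 * k) (sum b A)")
          case True
          then show ?thesis using step_contract[OF k0 R IH] by blast
        next
          case False
          have L: "loose k U m a c b"
            unfolding loose_def
          proof (intro allI impI)
            fix A assume A: "A \<subseteq> U" "2 \<le> card A" "A \<noteq> U"
            then have "bdry U m a c A > 2 * k - 2 + circ_norm (2 * k) (sum b A)"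
              using False by force
            moreover have "even (bdry U m a c A + sum b A)" by (rule D(8)[OF A(1)])
            moreover have "even (circ_norm (2 * k) (sum b A) + sum b A)"
              by (rule circ_norm_parity[OF n]) simp
            moreover have "2 * k + y \<le> x"
              if "x > 2 * k - 2 + y" "even (x + z)" "even (y + z)" for x y z :: int
              using that by presburger
            ultimately show "2 * k + circ_norm (2 * k) (sum b A) \<le> bdry U m a c A"
              by blast
          qed
          show ?thesis
          proof (cases "\<exists>v\<in>U. 2 * k dvd b v \<and> (X = {} \<or> X = {v})")
            case True
            then obtain v where v: "v \<in> U" "2 * k dvd b v" "X = {} \<or> X = {v}" by blast
            have "rooted k U m a c b {v}"
            proof (rule rootedI)
              show "2 * k - 2 + circ_norm (2 * k) (sum b A) \<le> bdry U m a c A"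
                if "A \<subseteq> U" "A \<noteq> {}" "A \<noteq> U" "A \<noteq> {v}" for A
                using D(9)[OF that(1-3)] that(2,4) v(3) by blast
              show "{v} = {} \<or> (\<exists>u\<in>U. {v} = {u} \<and> 2 * k dvd b u)"
                using v(1,2) by blast
            qed (fact D)+
            then show ?thesis using step_zero[OF k _ L IH card] by blast
          next
            case False
            then have "X = {}" using D(10) by blast
            then show ?thesis using step_nonzero[OF k _ L IH card] R False by blast
          qed
        qed
      qed
    qed
  qed
  then show ?thesis using assms(2) by blast
qed

section \<open>Orientations of multigraphs modulo an integer\<close>

definition graph_orientation :: "('v, 'e) multigraph \<Rightarrow> ('e \<Rightarrow> 'v) \<Rightarrow> ('e \<Rightarrow> 'v) \<Rightarrow> bool" where
  "graph_orientation G t h \<longleftrightarrow> (\<forall>e\<in>edges G. ends G e = Upair (t e) (h e))"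

lemma card_filter: "finite E \<Longrightarrow> int (card {e \<in> E. P e}) = (\<Sum>e\<in>E. of_bool (P e))"
  by (simp add: Int_def)

text \<open>Double counting, used for the sums of degrees, for cuts and for the sizes of the colour classes.\<close>

lemma sum_card_fibres:
  assumes "finite E" "finite A"
  shows "(\<Sum>v\<in>A. int (card {e \<in> E. g e = v \<and> P e})) = int (card {e \<in> E. g e \<in> A \<and> P e})"
proof -
  have "(\<Sum>v\<in>A. int (card {e \<in> E. g e = v \<and> P e})) = (\<Sum>v\<in>A. \<Sum>e\<in>E. of_bool (g e = v \<and> P e))"
    by (simp only: card_filter[OF assms(1)])
  also have "\<dots> = (\<Sum>e\<in>E. \<Sum>v\<in>A. of_bool (g e = v \<and> P e))" by (rule sum.swap)
  also have "\<dots> = (\<Sum>e\<in>E. of_bool (g e \<in> A \<and> P e))"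
  proof (rule sum.cong[OF refl])
    fix e
    have "(\<Sum>v\<in>A. of_bool (g e = v \<and> P e)) = (\<Sum>v\<in>A. if g e = v then of_bool (P e) else (0::int))"
      by (rule sum.cong) auto
    then show "(\<Sum>v\<in>A. of_bool (g e = v \<and> P e)) = (of_bool (g e \<in> A \<and> P e) :: int)"
      using assms(2) by simp
  qed
  finally show ?thesis by (simp only: card_filter[OF assms(1)])
qed

lemma orientation_exists:
  obtains t h where "graph_orientation G t h"
proof -
  have "\<forall>e. \<exists>p. ends G e = Upair (fst p) (snd p)" by (metis fst_conv snd_conv uprod_exhaust)
  then obtain p where "\<forall>e. ends G e = Upair (fst (p e)) (snd (p e))" by metis
  then show thesis using that[of "\<lambda>e. fst (p e)" "\<lambda>e. snd (p e)"] by (simp add: graph_orientation_def)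
qed

lemma orientation_in_verts:
  assumes "finite_multigraph G" "graph_orientation G t h" "e \<in> edges G"
  shows "t e \<in> verts G" "h e \<in> verts G"
  using assms by (auto simp: finite_multigraph_def graph_orientation_def)

lemma degree_orientation:
  assumes fin: "finite (edges G)" and o: "graph_orientation G t h"
  shows "degree G v = card {e \<in> edges G. t e = v} + card {e \<in> edges G. h e = v}"
proof -
  have "{e \<in> edges G. v \<in> set_uprod (ends G e)} = {e \<in> edges G. t e = v} \<union> {e \<in> edges G. h e = v}"
    using o by (auto simp: graph_orientation_def)
  moreover have "{e \<in> edges G. ends G e = Upair v v} = {e \<in> edges G. t e = v} \<inter> {e \<in> edges G. h e = v}"
    using o by (auto simp: graph_orientation_def)
  ultimately show ?thesis
    using card_Un_Int[of "{e \<in> edges G. t e = v}" "{e \<in> edges G. h e = v}"] fin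
    by (simp add: degree_def)
qed

lemma cut_size_orientation:
  assumes "graph_orientation G t h"
  shows "cut_size G A = card {e \<in> edges G. (t e \<in> A) \<noteq> (h e \<in> A)}"
proof -
  have "(\<exists>u w. Upair (t e) (h e) = Upair u w \<and> u \<in> A \<and> w \<notin> A) \<longleftrightarrow> (t e \<in> A) \<noteq> (h e \<in> A)" for e
    unfolding Upair_inject by blast
  then show ?thesis
    unfolding cut_size_def using assms
    by (intro arg_cong[of _ _ card] Collect_cong) (auto simp: graph_orientation_def)
qed

definition multiplicity :: "('v, 'e) multigraph \<Rightarrow> 'v \<Rightarrow> 'v \<Rightarrow> int" where
  "multiplicity G u w = int (card {e \<in> edges G. ends G e = Upair u w})"

lemma multiplicity_commute: "multiplicity G u w = multiplicity G w u"
  by (simp add: multiplicity_def Upair_inject) (metis Upair_inject)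

definition arcs :: "('v, 'e) multigraph \<Rightarrow> ('e \<Rightarrow> 'v) \<Rightarrow> ('e \<Rightarrow> 'v) \<Rightarrow> 'v \<Rightarrow> 'v \<Rightarrow> int" where
  "arcs G t h u w = int (card {e \<in> edges G. t e = u \<and> h e = w})"

lemma multiplicity_arcs:
  assumes "finite (edges G)" "graph_orientation G t h" "u \<noteq> w"
  shows "multiplicity G u w = arcs G t h u w + arcs G t h w u"
proof -
  have "{e \<in> edges G. ends G e = Upair u w}
      = {e \<in> edges G. t e = u \<and> h e = w} \<union> {e \<in> edges G. t e = w \<and> h e = u}"
    using assms(2) by (auto simp: graph_orientation_def)
  moreover have "{e \<in> edges G. t e = u \<and> h e = w} \<inter> {e \<in> edges G. t e = w \<and> h e = u} = {}"
    using assms(3) by auto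
  ultimately show ?thesis
    using assms(1) by (simp add: multiplicity_def arcs_def card_Un_disjoint)
qed

lemma sum_arcs:
  assumes "finite (edges G)" "finite A" "finite B"
  shows "(\<Sum>u\<in>A. \<Sum>w\<in>B. arcs G t h u w) = int (card {e \<in> edges G. t e \<in> A \<and> h e \<in> B})"
proof -
  have "(\<Sum>w\<in>B. arcs G t h u w) = int (card {e \<in> edges G. t e = u \<and> h e \<in> B})" for u
    using sum_card_fibres[OF assms(1,3), of h "\<lambda>e. t e = u"]
    by (simp add: arcs_def conj_commute)
  then show ?thesis using sum_card_fibres[OF assms(1,2), of t "\<lambda>e. h e \<in> B"] by simp
qed

lemma cut_multiplicity:
  assumes G: "finite_multigraph G" and A: "A \<subseteq> verts G"
  shows "cut (verts G) (multiplicity G) A = int (cut_size G A)"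
proof -
  obtain t h where o: "graph_orientation G t h" using orientation_exists by metis
  have fin: "finite (edges G)" "finite (verts G)" using G by (auto simp: finite_multigraph_def)
  then have finA: "finite A" "finite (verts G - A)" using A finite_subset by auto
  note iv = orientation_in_verts[OF G o]
  have "cut (verts G) (multiplicity G) A
      = (\<Sum>u\<in>A. \<Sum>w\<in>verts G - A. arcs G t h u w + arcs G t h w u)"
    unfolding cut_def by (intro sum.cong refl multiplicity_arcs[OF fin(1) o]) auto
  also have "\<dots> = (\<Sum>u\<in>A. \<Sum>w\<in>verts G - A. arcs G t h u w) + (\<Sum>w\<in>verts G - A. \<Sum>u\<in>A. arcs G t h w u)"
    by (simp add: sum.distrib) (rule sum.swap)
  also have "\<dots> = int (card {e \<in> edges G. t e \<in> A \<and> h e \<in> verts G - A})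
      + int (card {e \<in> edges G. t e \<in> verts G - A \<and> h e \<in> A})"
    by (simp only: sum_arcs[OF fin(1) finA] sum_arcs[OF fin(1) finA(2,1)])
  also have "\<dots> = int (card ({e \<in> edges G. t e \<in> A \<and> h e \<in> verts G - A}
      \<union> {e \<in> edges G. t e \<in> verts G - A \<and> h e \<in> A}))"
    by (subst card_Un_disjoint) (use fin in auto)
  also have "{e \<in> edges G. t e \<in> A \<and> h e \<in> verts G - A} \<union> {e \<in> edges G. t e \<in> verts G - A \<and> h e \<in> A}
      = {e \<in> edges G. (t e \<in> A) \<noteq> (h e \<in> A)}"
    using iv by auto
  finally show ?thesis by (simp add: cut_size_orientation[OF o])
qed

text \<open>The number \<open>i\<close> is the number of edges with both ends in \<open>A\<close>.\<close>

lemma sum_degree: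
  assumes G: "finite_multigraph G" and A: "A \<subseteq> verts G"
  obtains i where "(\<Sum>v\<in>A. int (degree G v)) = int (cut_size G A) + 2 * i"
    "A = verts G \<longrightarrow> i = int (card (edges G))"
proof -
  obtain t h where o: "graph_orientation G t h" using orientation_exists by metis
  have fin: "finite (edges G)" "finite (verts G)" using G by (auto simp: finite_multigraph_def)
  then have finA: "finite A" using A finite_subset by auto
  have "(\<Sum>v\<in>A. int (degree G v)) = int (card {e \<in> edges G. t e \<in> A}) + int (card {e \<in> edges G. h e \<in> A})"
    using sum_card_fibres[OF fin(1) finA, of t "\<lambda>_. True"] sum_card_fibres[OF fin(1) finA, of h "\<lambda>_. True"]
    by (simp add: degree_orientation[OF fin(1) o] sum.distrib)
  also have "\<dots> = (\<Sum>e\<in>edges G. of_bool (t e \<in> A)) + (\<Sum>e\<in>edges G. of_bool (h e \<in> A))"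
    by (simp only: card_filter[OF fin(1)])
  also have "\<dots> = (\<Sum>e\<in>edges G. of_bool ((t e \<in> A) \<noteq> (h e \<in> A)) + 2 * of_bool (t e \<in> A \<and> h e \<in> A))"
    unfolding sum.distrib[symmetric] by (rule sum.cong) auto
  also have "\<dots> = int (cut_size G A) + 2 * int (card {e \<in> edges G. t e \<in> A \<and> h e \<in> A})"
    by (simp only: sum.distrib sum_distrib_left[symmetric] cut_size_orientation[OF o] card_filter[OF fin(1)])
  finally show thesis
  proof (rule that)
    show "A = verts G \<longrightarrow> int (card {e \<in> edges G. t e \<in> A \<and> h e \<in> A}) = int (card (edges G))"
      using orientation_in_verts[OF G o] by (auto intro!: arg_cong[of _ _ card])
  qed
qed

text \<open>Among the edges with ends \<open>u\<close> and \<open>w\<close>, any \<open>f u w\<close> can be directed from \<open>u\<close> to \<open>w\<close>. As the ends form an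
  unordered pair \<open>P\<close>, an ordering \<open>r P\<close> of each pair is fixed first; \<open>S P\<close> consists of the edges that are
  directed along it.\<close>

lemma realise_arc_counts:
  fixes G :: "('v, 'e) multigraph"
  assumes fin: "finite (edges G)"
    and f: "\<And>u w. u \<in> V \<Longrightarrow> w \<in> V \<Longrightarrow> u \<noteq> w \<Longrightarrow> 0 \<le> f u w \<and> f u w + f w u = multiplicity G u w"
  obtains t h where "graph_orientation G t h"
    "\<And>u w. u \<in> V \<Longrightarrow> w \<in> V \<Longrightarrow> u \<noteq> w \<Longrightarrow> arcs G t h u w = f u w"
proof -
  define E where "E P = {e \<in> edges G. ends G e = P}" for P
  have finE: "finite (E P)" for P using fin by (simp add: E_def)
  have "\<forall>P :: 'v uprod. \<exists>q. P = Upair (fst q) (snd q)" by (metis fst_conv snd_conv uprod_exhaust)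
  then obtain r :: "'v uprod \<Rightarrow> 'v \<times> 'v" where r: "\<And>P. P = Upair (fst (r P)) (snd (r P))" by metis
  have "\<exists>S. S \<subseteq> E P \<and> (fst (r P) \<in> V \<longrightarrow> snd (r P) \<in> V \<longrightarrow> fst (r P) \<noteq> snd (r P) \<longrightarrow>
      int (card S) = f (fst (r P)) (snd (r P)))" for P
  proof (cases "fst (r P) \<in> V \<and> snd (r P) \<in> V \<and> fst (r P) \<noteq> snd (r P)")
    case True
    then have "0 \<le> f (fst (r P)) (snd (r P))" "f (fst (r P)) (snd (r P)) \<le> int (card (E P))"
      using f[of "fst (r P)" "snd (r P)"] f[of "snd (r P)" "fst (r P)"]
      by (auto simp: multiplicity_def E_def simp flip: r[of P])
    then have "nat (f (fst (r P)) (snd (r P))) \<le> card (E P)" by simp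
    then obtain S where "S \<subseteq> E P" "card S = nat (f (fst (r P)) (snd (r P)))"
      using obtain_subset_with_card_n by metis
    then show ?thesis using \<open>0 \<le> f (fst (r P)) (snd (r P))\<close> by auto
  qed auto
  then obtain S where S: "\<And>P. S P \<subseteq> E P" and cS: "\<And>P. fst (r P) \<in> V \<Longrightarrow> snd (r P) \<in> V \<Longrightarrow>
      fst (r P) \<noteq> snd (r P) \<Longrightarrow> int (card (S P)) = f (fst (r P)) (snd (r P))"
    by metis
  define t where "t e = (if e \<in> S (ends G e) then fst (r (ends G e)) else snd (r (ends G e)))" for e
  define h where "h e = (if e \<in> S (ends G e) then snd (r (ends G e)) else fst (r (ends G e)))" for e
  have ends: "ends G e = Upair (t e) (h e)" for e
  proof -
    have "Upair (t e) (h e) = Upair (fst (r (ends G e))) (snd (r (ends G e)))"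
      by (simp add: t_def h_def Upair_inject)
    also have "\<dots> = ends G e" by (rule r[symmetric])
    finally show ?thesis by (rule sym)
  qed
  show thesis
  proof (rule that)
    show o: "graph_orientation G t h" using ends by (simp add: graph_orientation_def)
    show "arcs G t h u w = f u w" if uw: "u \<in> V" "w \<in> V" "u \<noteq> w" for u w
    proof -
      define P where "P = Upair u w"
      have "Upair (fst (r P)) (snd (r P)) = Upair u w"
        by (rule trans[OF r[symmetric] P_def])
      then consider "fst (r P) = u" "snd (r P) = w" | "fst (r P) = w" "snd (r P) = u"
        unfolding Upair_inject by blast
      then show ?thesis
      proof cases
        case 1
        have "{e \<in> edges G. t e = u \<and> h e = w} = S P"
        proof (intro subset_antisym subsetI)
          fix e assume e: "e \<in> {e \<in> edges G. t e = u \<and> h e = w}"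
          then have "ends G e = P" using ends[of e] by (simp add: P_def)
          then show "e \<in> S P" using e 1 uw(3) by (auto simp: t_def split: if_splits)
        next
          fix e assume e: "e \<in> S P"
          then have "e \<in> edges G" "ends G e = P" using S[of P] by (auto simp: E_def)
          then show "e \<in> {e \<in> edges G. t e = u \<and> h e = w}" using e 1 by (simp add: t_def h_def)
        qed
        then show ?thesis using cS[of P] 1 uw by (simp add: arcs_def)
      next
        case 2
        have "{e \<in> edges G. t e = u \<and> h e = w} = E P - S P"
        proof (intro subset_antisym subsetI)
          fix e assume e: "e \<in> {e \<in> edges G. t e = u \<and> h e = w}"
          then have "ends G e = P" using ends[of e] by (simp add: P_def)
          then show "e \<in> E P - S P" using e 2 uw(3) by (auto simp: t_def E_def split: if_splits)
        next
          fix e assume e: "e \<in> E P - S P"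
          then have "e \<in> edges G" "ends G e = P" by (auto simp: E_def)
          then show "e \<in> {e \<in> edges G. t e = u \<and> h e = w}" using e 2 by (simp add: t_def h_def)
        qed
        moreover have "int (card (E P - S P)) = int (card (E P)) - int (card (S P))"
          using card_Diff_subset[OF finite_subset[OF S finE] S, of P] card_mono[OF finE S, of P]
          by simp
        moreover have "int (card (E P)) = multiplicity G u w"
          by (simp add: multiplicity_def E_def P_def)
        ultimately show ?thesis using cS[of P] 2 uw f[of u w] f[of w u] by (simp add: arcs_def)
      qed
    qed
  qed
qed

text \<open>For \<open>k \<ge> 2\<close> the given graph is an instance of \<open>rooted_orientable\<close> with a root without arcs.
  The target \<open>2 p v - d v\<close> for out-degree minus in-degree modulo \<open>2k\<close> expresses out-degree \<open>p v\<close> modulo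
  \<open>k\<close>. The boundary condition asks for \<open>2k - 2\<close> plus a distance of at most \<open>k\<close>; this is at most
  \<open>3k - 3\<close> unless the distance is exactly \<open>k\<close>, and then the boundary has the parity of \<open>k\<close> and
  cannot be \<open>3k - 3\<close>.\<close>

theorem modulo_orientation:
  assumes k: "k > 0" and G: "finite_multigraph G" and conn: "edge_connected (3 * (k - 1)) G"
    and p: "int k dvd sum p (verts G) - int (card (edges G))"
  obtains t h where "graph_orientation G t h"
    "\<And>v. v \<in> verts G \<Longrightarrow> int k dvd int (card {e \<in> edges G. t e = v}) - p v"
proof (cases "k = 1")
  case True
  then show thesis using orientation_exists[of G] that by (metis of_nat_1 one_dvd)
next
  case False
  then have k2: "int k \<ge> 2" using k by simp
  then have n: "2 * int k > 0" by simp
  let ?V = "verts G"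
  have fin: "finite (edges G)" "finite ?V" using G by (auto simp: finite_multigraph_def)
  define b where "b v = 2 * p v - int (degree G v)" for v
  have sb: "sum b A = 2 * sum p A - (\<Sum>v\<in>A. int (degree G v))" for A
    by (simp add: b_def sum_subtractf sum_distrib_left)
  have bd: "bdry ?V (multiplicity G) (\<lambda>_. 0) (\<lambda>_. 0) A = int (cut_size G A)" if "A \<subseteq> ?V" for A
    by (simp add: bdry_def cut_multiplicity[OF G that])
  have ev: "even (int (cut_size G A) + sum b A)" if A: "A \<subseteq> ?V" for A
    by (rule sum_degree[OF G A]) (simp add: sb)
  have "rooted (int k) ?V (multiplicity G) (\<lambda>_. 0) (\<lambda>_. 0) b {}"
  proof (rule rootedI)
    show "0 \<le> multiplicity G u w" for u w by (simp add: multiplicity_def)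
    show "multiplicity G u w = multiplicity G w u" for u w by (rule multiplicity_commute)
    show "2 * int k dvd sum (\<lambda>_. 0) ?V - sum (\<lambda>_. 0) ?V - sum b ?V"
    proof (rule sum_degree[OF G subset_refl])
      fix i assume "(\<Sum>v\<in>?V. int (degree G v)) = int (cut_size G ?V) + 2 * i"
        "?V = ?V \<longrightarrow> i = int (card (edges G))"
      moreover have "cut_size G ?V = 0"
      proof -
        obtain t h where o: "graph_orientation G t h" using orientation_exists by metis
        have "{e \<in> edges G. (t e \<in> ?V) \<noteq> (h e \<in> ?V)} = {}"
          using orientation_in_verts[OF G o] by auto
        then show ?thesis by (simp only: cut_size_orientation[OF o] card.empty)
      qed
      ultimately have "sum (\<lambda>_. 0) ?V - sum (\<lambda>_. 0) ?V - sum b ?V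
          = - (2 * (sum p ?V - int (card (edges G))))" by (simp add: sb)
      then show ?thesis using p by (simp only: dvd_minus_iff) (rule mult_dvd_mono, simp_all)
    qed
    show "sum (\<lambda>_. 0) ?V + sum (\<lambda>_. 0) ?V
        \<le> 2 * int k - 2 + circ_norm (2 * int k) (sum (\<lambda>_. 0) ?V - sum (\<lambda>_. 0) ?V)"
      using k2 circ_norm_nonneg[OF n, of 0] by simp
    show "even (bdry ?V (multiplicity G) (\<lambda>_. 0) (\<lambda>_. 0) A + sum b A)" if "A \<subseteq> ?V" for A
      unfolding bd[OF that] by (rule ev[OF that])
    show "2 * int k - 2 + circ_norm (2 * int k) (sum b A) \<le> bdry ?V (multiplicity G) (\<lambda>_. 0) (\<lambda>_. 0) A"
      if A: "A \<subseteq> ?V" "A \<noteq> {}" "A \<noteq> ?V" "A \<noteq> {}" for A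
    proof -
      have "3 * (k - 1) \<le> cut_size G A"
        using conn A by (auto simp: edge_connected_def)
      then have "3 * int k - 3 \<le> int (cut_size G A)" using k by linarith
      moreover have "even (circ_norm (2 * int k) (sum b A) + sum b A)"
        by (rule circ_norm_parity[OF n]) simp
      moreover have "circ_norm (2 * int k) (sum b A) \<le> int k"
        using circ_norm_le_half[OF n, of "sum b A"] by simp
      moreover have "2 * K - 2 + N \<le> d"
        if "3 * K - 3 \<le> d" "even (N + s)" "N \<le> K" "even (d + s)" for K N d s :: int
      proof (cases "N = K")
        case True
        then have "d \<noteq> 3 * K - 3" using that by presburger
        then show ?thesis using that True by linarith
      qed (use that in linarith)
      ultimately show ?thesis using ev[OF A(1)] unfolding bd[OF A(1)] by blast
    qed
  qed (use fin in auto)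
  then have "orientable (int k) ?V (multiplicity G) (\<lambda>_. 0) (\<lambda>_. 0) b"
    by (rule rooted_orientable[OF k2])
  then obtain f where f: "\<And>u w. u \<in> ?V \<Longrightarrow> w \<in> ?V \<Longrightarrow> u \<noteq> w \<Longrightarrow> 0 \<le> f u w \<and> f u w + f w u = multiplicity G u w"
    and nf: "\<And>u. u \<in> ?V \<Longrightarrow> 2 * int k dvd net ?V f u + 0 - 0 - b u"
    unfolding orientable_def by metis
  obtain t h where o: "graph_orientation G t h"
    and tf: "\<And>u w. u \<in> ?V \<Longrightarrow> w \<in> ?V \<Longrightarrow> u \<noteq> w \<Longrightarrow> arcs G t h u w = f u w"
    using realise_arc_counts[OF fin(1), of ?V f] f by metis
  note iv = orientation_in_verts[OF G o]
  show thesis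
  proof (rule that[OF o])
    fix v assume v: "v \<in> ?V"
    have "net ?V f v = net ?V (arcs G t h) v"
      unfolding net_def
    proof (rule sum.cong[OF refl])
      fix w assume "w \<in> ?V"
      then show "f v w - f w v = arcs G t h v w - arcs G t h w v"
        using tf[of v w] tf[of w v] v by (cases "v = w") auto
    qed
    also have "\<dots> = (\<Sum>w\<in>?V. arcs G t h v w) - (\<Sum>w\<in>?V. arcs G t h w v)"
      by (simp add: net_def sum_subtractf)
    also have "(\<Sum>w\<in>?V. arcs G t h v w) = int (card {e \<in> edges G. t e = v})"
    proof -
      have "{e \<in> edges G. t e \<in> {v} \<and> h e \<in> ?V} = {e \<in> edges G. t e = v}" using iv by auto
      then show ?thesis using sum_arcs[OF fin(1) _ fin(2), of "{v}" t h] by simp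
    qed
    also have "(\<Sum>w\<in>?V. arcs G t h w v) = int (card {e \<in> edges G. h e = v})"
    proof -
      have "{e \<in> edges G. t e \<in> ?V \<and> h e \<in> {v}} = {e \<in> edges G. h e = v}" using iv by auto
      then show ?thesis using sum_arcs[OF fin, of "{v}" t h] by simp
    qed
    finally have "net ?V f v + 0 - 0 - b v = 2 * (int (card {e \<in> edges G. t e = v}) - p v)"
      by (simp add: b_def degree_orientation[OF fin(1) o])
    then have "2 * int k dvd 2 * (int (card {e \<in> edges G. t e = v}) - p v)"
      using nf[OF v] by (simp only:)
    then show "int k dvd int (card {e \<in> edges G. t e = v}) - p v"
      by (metis dvd_times_left_cancel_iff zero_neq_numeral)
  qed
qed

section \<open>Decomposition into factors\<close>

lemma int_div_less:
  fixes n m k :: int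
  assumes "k > 0" "n < m * k"
  shows "n div k < m"
proof (rule ccontr)
  assume "\<not> n div k < m"
  then have "m * k \<le> n div k * k" using assms(1) by (intro mult_right_mono) auto
  then show False using assms div_mult_mod_eq[of n k] pos_mod_sign[of k n] by linarith
qed

text \<open>Numbers that pairwise differ by at most one lie between the floor and the ceiling of their mean.
  The ceiling of \<open>N/k\<close> appears as \<open>- (- N div k)\<close>.\<close>

lemma equitable_class_bounds:
  fixes x :: "nat \<Rightarrow> int"
  assumes k: "k > 0" and i: "i \<in> {1..k}" and N: "sum x {1..k} = N"
    and eq: "\<And>i j. i \<in> {1..k} \<Longrightarrow> j \<in> {1..k} \<Longrightarrow> x i \<le> x j + 1"
  shows "N div int k \<le> x i" "x i \<le> - ((- N) div int k)"
proof -
  have k0: "int k > 0" using k by simp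
  have s: "N = x i + sum x ({1..k} - {i})" using i N by (simp add: sum.remove)
  have c: "int (card ({1..k} - {i})) = int k - 1" using i k by (simp add: of_nat_diff)
  have "sum x ({1..k} - {i}) \<le> (int k - 1) * (x i + 1)"
    using sum_bounded_above[of "{1..k} - {i}" x "x i + 1"] eq i by (simp add: c)
  then have "N < (x i + 1) * int k" using s by (simp add: algebra_simps)
  then have "N div int k < x i + 1" by (rule int_div_less[OF k0])
  then show "N div int k \<le> x i" by simp
  have "(int k - 1) * (x i - 1) \<le> sum x ({1..k} - {i})"
    using sum_bounded_below[of "{1..k} - {i}" "x i - 1" x] eq i by (force simp: c)
  then have "- N < (- x i + 1) * int k" using s by (simp add: algebra_simps)
  then have "(- N) div int k < - x i + 1" by (rule int_div_less[OF k0])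
  then show "x i \<le> - ((- N) div int k)" by simp
qed

text \<open>Subtracting \<open>x\<close> from \<open>y\<close> causes no borrow modulo \<open>k\<close>.\<close>

lemma div_split:
  fixes x y k :: int
  assumes "k > 0" "x mod k \<le> y mod k"
  shows "x div k + (y - x) div k = y div k"
proof -
  have "y - x = k * (y div k - x div k) + (y mod k - x mod k)"
    using div_mult_mod_eq[of y k] div_mult_mod_eq[of x k] by (simp add: algebra_simps)
  moreover have "0 \<le> y mod k - x mod k" "y mod k - x mod k < k"
    using assms pos_mod_bound[of k y] pos_mod_sign[of k x] by linarith+
  ultimately have "(y - x) div k = y div k - x div k"
    by (simp add: div_pos_pos_trivial)
  then show ?thesis by simp
qed

lemma orientation_decomposition:
  assumes k: "k > 0" and G: "finite_multigraph G" and o: "graph_orientation G t h"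
  obtains F where "edge_decomposition G k F"
    "\<And>v i. i \<in> {1..k} \<Longrightarrow> int (card {e \<in> edges G. t e = v}) div int k
        + int (card {e \<in> edges G. h e = v}) div int k \<le> int (degree (F i) v)"
    "\<And>v i. i \<in> {1..k} \<Longrightarrow> int (degree (F i) v)
      \<le> - ((- int (card {e \<in> edges G. t e = v})) div int k) - ((- int (card {e \<in> edges G. h e = v})) div int k)"
proof -
  have fin: "finite (edges G)" using G by (simp add: finite_multigraph_def)
  obtain c where c: "\<And>e. e \<in> edges G \<Longrightarrow> c e \<in> {1..k}"
    and eq: "\<And>s v i j. s \<in> {t, h} \<Longrightarrow> i \<in> {1..k} \<Longrightarrow> j \<in> {1..k} \<Longrightarrow>
      card {e \<in> edges G. s e = v \<and> c e = i} \<le> card {e \<in> edges G. s e = v \<and> c e = j} + 1"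
    using equitable_colouring[OF fin k, of t h] by blast
  define F where "F i = \<lparr>verts = verts G, edges = {e \<in> edges G. c e = i}, ends = ends G\<rparr>" for i
  have dec: "edge_decomposition G k F"
    using c by (auto simp: edge_decomposition_def factor_of_def F_def disjoint_family_on_def)
  have dF: "int (degree (F i) v) = int (card {e \<in> edges G. t e = v \<and> c e = i})
      + int (card {e \<in> edges G. h e = v \<and> c e = i})" for i v
  proof -
    have "graph_orientation (F i) t h" using o by (simp add: graph_orientation_def F_def)
    from degree_orientation[OF _ this, of v] fin show ?thesis
      by (simp add: F_def conj_ac)
  qed
  have side: "int (card {e \<in> edges G. s e = v}) div int k \<le> int (card {e \<in> edges G. s e = v \<and> c e = i})
     \<and> int (card {e \<in> edges G. s e = v \<and> c e = i}) \<le> - ((- int (card {e \<in> edges G. s e = v})) div int k)"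
    if s: "s \<in> {t, h}" and i: "i \<in> {1..k}" for s i v
  proof -
    have "(\<Sum>i\<in>{1..k}. int (card {e \<in> edges G. s e = v \<and> c e = i})) = int (card {e \<in> edges G. s e = v})"
    proof -
      have "{e \<in> edges G. c e \<in> {1..k} \<and> s e = v} = {e \<in> edges G. s e = v}" using c by auto
      then show ?thesis using sum_card_fibres[OF fin, of "{1..k}" c "\<lambda>e. s e = v"]
        by (simp add: conj_commute)
    qed
    moreover have "int (card {e \<in> edges G. s e = v \<and> c e = i}) \<le> int (card {e \<in> edges G. s e = v \<and> c e = j}) + 1"
      if "i \<in> {1..k}" "j \<in> {1..k}" for i j
      using eq[OF s that, of v] by linarith
    ultimately show ?thesis
      using equitable_class_bounds[OF k i, of "\<lambda>i. int (card {e \<in> edges G. s e = v \<and> c e = i})"] by blast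
  qed
  show thesis
  proof (rule that[of F])
    show "edge_decomposition G k F" by (rule dec)
    fix v i assume i: "i \<in> {1..k}"
    show "int (card {e \<in> edges G. t e = v}) div int k + int (card {e \<in> edges G. h e = v}) div int k
        \<le> int (degree (F i) v)"
      "int (degree (F i) v) \<le> - ((- int (card {e \<in> edges G. t e = v})) div int k)
        - ((- int (card {e \<in> edges G. h e = v})) div int k)"
      using side[of t i v] side[of h i v] i unfolding dF by simp_all
  qed
qed

text \<open>In part (a) the out-degrees are prescribed as residues \<open>p v\<close> with \<open>0 \<le> p v \<le> d v mod k\<close> whose sum is
  the number of edges modulo \<open>k\<close>. This number is at most \<open>k - 1\<close>, so the hypothesis leaves enough room.
  In part (b) they are prescribed as \<open>- q v\<close> with \<open>0 \<le> q v \<le> (- d v) mod k\<close>, and the sum of all \<open>q v\<close> is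
  minus the number of edges modulo \<open>k\<close>.\<close>

theorem theorem1p5:
  fixes G :: "('v, 'e) multigraph" and k :: nat
  assumes "k > 0"
    and "finite_multigraph G"
    and "edge_connected (3 * (k - 1)) G"
  shows "((\<Sum>v\<in>verts G. residue (int (degree G v)) k) \<ge> int k - 1 \<longrightarrow>
           (\<exists>F. edge_decomposition G k F \<and>
             (\<forall>v\<in>verts G. \<forall>i\<in>{1..k}.
               int (degree (F i) v) \<ge> \<lfloor>real (degree G v) / real k\<rfloor>))) \<and>
         ((\<Sum>v\<in>verts G. residue (int k - int (degree G v)) k) \<ge> int k - 1 \<longrightarrow>
           (\<exists>F. edge_decomposition G k F \<and>
             (\<forall>v\<in>verts G. \<forall>i\<in>{1..k}.
               int (degree (F i) v) \<le> \<lceil>real (degree G v) / real k\<rceil>)))"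
proof (intro conjI impI)
  note k = assms(1) and G = assms(2)
  have fin: "finite (edges G)" "finite (verts G)" using G by (auto simp: finite_multigraph_def)
  have k0: "int k > 0" using k by simp
  let ?d = "\<lambda>v. int (degree G v)" and ?m = "int (card (edges G))"
  {
    assume "(\<Sum>v\<in>verts G. residue (?d v) k) \<ge> int k - 1"
    then have "?m mod int k \<le> (\<Sum>v\<in>verts G. ?d v mod int k)"
      using pos_mod_bound[OF k0, of ?m] by (simp add: residue_def)
    then obtain p where p: "\<And>v. v \<in> verts G \<Longrightarrow> 0 \<le> p v \<and> p v \<le> ?d v mod int k"
      and sp: "sum p (verts G) = ?m mod int k"
      using distribute_sum[OF fin(2), of "\<lambda>v. ?d v mod int k" "?m mod int k"] k0 by auto
    have "int k dvd sum p (verts G) - ?m" unfolding sp by (simp add: mod_eq_dvd_iff[symmetric])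
    then obtain t h where o: "graph_orientation G t h"
      and t: "\<And>v. v \<in> verts G \<Longrightarrow> int k dvd int (card {e \<in> edges G. t e = v}) - p v"
      by (rule modulo_orientation[OF k G assms(3)]) (blast intro: that)
    obtain F where F: "edge_decomposition G k F"
      "\<And>v i. i \<in> {1..k} \<Longrightarrow> int (card {e \<in> edges G. t e = v}) div int k
        + int (card {e \<in> edges G. h e = v}) div int k \<le> int (degree (F i) v)"
      "\<And>v i. i \<in> {1..k} \<Longrightarrow> int (degree (F i) v)
      \<le> - ((- int (card {e \<in> edges G. t e = v})) div int k) - ((- int (card {e \<in> edges G. h e = v})) div int k)"
      by (rule orientation_decomposition[OF k G o]) (blast intro: that)
    have "\<lfloor>real (degree G v) / real k\<rfloor> \<le> int (degree (F i) v)" if v: "v \<in> verts G" and i: "i \<in> {1..k}" for v i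
    proof -
      let ?x = "int (card {e \<in> edges G. t e = v})"
      have "?x mod int k = p v mod int k" using t[OF v] by (simp add: mod_eq_dvd_iff)
      also have "\<dots> = p v" using p[OF v] pos_mod_bound[OF k0, of "?d v"] by simp
      finally have "?x mod int k \<le> ?d v mod int k" using p[OF v] by simp
      from div_split[OF k0 this] have "?d v div int k \<le> int (degree (F i) v)"
        using F(2)[OF i, of v] by (simp add: degree_orientation[OF fin(1) o])
      then show ?thesis by (simp add: floor_divide_of_nat_eq zdiv_int)
    qed
    then show "\<exists>F. edge_decomposition G k F \<and> (\<forall>v\<in>verts G. \<forall>i\<in>{1..k}.
               int (degree (F i) v) \<ge> \<lfloor>real (degree G v) / real k\<rfloor>)"
      using F(1) by blast
  next
    assume "(\<Sum>v\<in>verts G. residue (int k - ?d v) k) \<ge> int k - 1"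
    moreover have "(int k - x) mod int k = (- x) mod int k" for x
      using mod_add_self1[of "int k" "- x"] by simp
    ultimately have "(- ?m) mod int k \<le> (\<Sum>v\<in>verts G. (- ?d v) mod int k)"
      using pos_mod_bound[OF k0, of "- ?m"] by (simp add: residue_def)
    then obtain q where q: "\<And>v. v \<in> verts G \<Longrightarrow> 0 \<le> q v \<and> q v \<le> (- ?d v) mod int k"
      and sq: "sum q (verts G) = (- ?m) mod int k"
      using distribute_sum[OF fin(2), of "\<lambda>v. (- ?d v) mod int k" "(- ?m) mod int k"] k0 by auto
    have "int k dvd sum q (verts G) - (- ?m)" unfolding sq by (simp only: mod_eq_dvd_iff[symmetric] mod_mod_trivial)
    moreover have "sum (\<lambda>v. - q v) (verts G) - ?m = - (sum q (verts G) - (- ?m))"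
      by (simp add: sum_negf)
    ultimately have "int k dvd sum (\<lambda>v. - q v) (verts G) - ?m" by (simp only: dvd_minus_iff)
    then obtain t h where o: "graph_orientation G t h"
      and t: "\<And>v. v \<in> verts G \<Longrightarrow> int k dvd int (card {e \<in> edges G. t e = v}) - (- q v)"
      by (rule modulo_orientation[OF k G assms(3)]) (blast intro: that)
    obtain F where F: "edge_decomposition G k F"
      "\<And>v i. i \<in> {1..k} \<Longrightarrow> int (card {e \<in> edges G. t e = v}) div int k
        + int (card {e \<in> edges G. h e = v}) div int k \<le> int (degree (F i) v)"
      "\<And>v i. i \<in> {1..k} \<Longrightarrow> int (degree (F i) v)
      \<le> - ((- int (card {e \<in> edges G. t e = v})) div int k) - ((- int (card {e \<in> edges G. h e = v})) div int k)"
      by (rule orientation_decomposition[OF k G o]) (blast intro: that)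
    have "int (degree (F i) v) \<le> \<lceil>real (degree G v) / real k\<rceil>" if v: "v \<in> verts G" and i: "i \<in> {1..k}" for v i
    proof -
      let ?x = "int (card {e \<in> edges G. t e = v})"
      have "int k dvd - ?x - q v" using t[OF v] by (metis dvd_minus_iff minus_diff_eq minus_diff_commute)
      then have "(- ?x) mod int k = q v mod int k" by (simp only: mod_eq_dvd_iff)
      also have "\<dots> = q v" using q[OF v] pos_mod_bound[OF k0, of "- ?d v"] by simp
      finally have "(- ?x) mod int k \<le> (- ?d v) mod int k" using q[OF v] by simp
      from div_split[OF k0 this] have "int (degree (F i) v) \<le> - ((- ?d v) div int k)"
        using F(3)[OF i, of v] by (simp add: degree_orientation[OF fin(1) o])
      moreover have "\<lceil>real (degree G v) / real k\<rceil> = - ((- ?d v) div int k)"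
        using floor_divide_of_int_eq[of "- ?d v" "int k", where ?'a = real] by (simp add: ceiling_def)
      ultimately show ?thesis by simp
    qed
    then show "\<exists>F. edge_decomposition G k F \<and> (\<forall>v\<in>verts G. \<forall>i\<in>{1..k}.
               int (degree (F i) v) \<le> \<lceil>real (degree G v) / real k\<rceil>)"
      using F(1) by blast
  }
qed

end
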